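(* Let $l\ge 1$ and let $\mathcal{P}=\{P_0,\dots,P_{l-1}\}$ be a partition of $\omega$ into $l$ infinite sets such that $\min P_i<\min P_j$ whenever $i<j$. Let $\mathcal{E}^{\mathcal{P}}_\infty$ be the set of all equivalence relations $E$ on $\omega$ such that (a) $E$ has infinitely many equivalence classes, and (b) for every $k<\omega$, $p_k(E)\in P_n$ where $n<l$ and $n\equiv k \pmod l$. Then $(\mathcal{E}^{\mathcal{P}}_\infty,\le,r)$ is a topological Ramsey space.
   Context: For an equivalence relation $E$ on $\omega$, $p(E)$ denotes the set of minimal elements of the equivalence classes of $E$, and $(p_k(E))_{k<\omega}$ is its increasing enumeration (when $E$ has infinitely many classes). For equivalence relations $E,F$ on the same set, $E\le F$ means every $E$-class is a union of $F$-classes ($E$ is a coarsening of $F$). For a set $\mathcal{R}$ of equivalence relations on $\omega$ with infinitely many classes: the restriction map is $r_n(E)=E\restriction\{0,1,\dots,p_n(E)-1\}$ (so $r_0(E)=\emptyset$); $\mathcal{AR}$ is the set of all $r_n(E)$ with $E\in\mathcal{R}$, $n<\omega$; for $a\in\mathcal{AR}$ and $B\in\mathcal{R}$, $[a,B]=\{A\in\mathcal{R}: A\le B \text{ and } r_n(A)=a \text{ for some } n\}$. The Ellentuck topology on $\mathcal{R}$ is the topology generated by the sets $[a,B]$. A set $\mathcal{X}\subseteq\mathcal{R}$ has the property of Baire if $\mathcal{X}=\mathcal{O}\triangle M$ with $\mathcal{O}$ Ellentuck open and $M$ Ellentuck meagre; $\mathcal{X}$ is Ramsey if for every non-empty $[a,B]$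 there is $A\in[a,B]$ with $[a,A]\subseteq\mathcal{X}$ or $[a,A]\cap\mathcal{X}=\emptyset$, and Ramsey null if the second alternative can always be achieved. $(\mathcal{R},\le,r)$ is a topological Ramsey space if a subset of $\mathcal{R}$ has the property of Baire iff it is Ramsey, and is Ellentuck meagre iff it is Ramsey null. *)

theory Defs
  imports "HOL-Analysis.Analysis" "HOL-Library.Infinite_Set" "HOL-Library.Disjoint_Sets"
begin

definition class_minima :: "nat rel \<Rightarrow> nat set" where
  "class_minima E = (\<lambda>C. LEAST x. x \<in> C) ` (UNIV // E)"

(* The increasing enumeration; only meaningful when E has infinitely many classes. *)
definition class_min :: "nat rel \<Rightarrow> nat \<Rightarrow> nat" where
  "class_min E k = enumerate (class_minima E) k"

definition coarsening :: "nat rel \<Rightarrow> nat rel \<Rightarrow> bool" where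
  "coarsening E F \<longleftrightarrow> (\<forall>C \<in> UNIV // E. \<exists>\<C> \<subseteq> UNIV // F. C = \<Union>\<C>)"

(* Since E is reflexive, the domain {..<class_min E n} of the restriction
   can be recovered from the set of pairs as its field. *)
definition restr :: "nat \<Rightarrow> nat rel \<Rightarrow> nat rel" where
  "restr n E = E \<inter> ({..<class_min E n} \<times> {..<class_min E n})"

definition approximations :: "nat rel set \<Rightarrow> nat rel set" where
  "approximations R = {restr n E | n E. E \<in> R}"

definition basic_set :: "nat rel set \<Rightarrow> nat rel \<Rightarrow> nat rel \<Rightarrow> nat rel set" where
  "basic_set R a B = {A \<in> R. coarsening A B \<and> (\<exists>n. restr n A = a)}"

definition ellentuck :: "nat rel set \<Rightarrow> nat rel topology" where
  "ellentuck R =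
     topology_generated_by {basic_set R a B | a B. a \<in> approximations R \<and> B \<in> R}"

definition nowhere_dense_in :: "'a topology \<Rightarrow> 'a set \<Rightarrow> bool" where
  "nowhere_dense_in T S \<longleftrightarrow> S \<subseteq> topspace T \<and> T interior_of (T closure_of S) = {}"

definition meagre_in :: "'a topology \<Rightarrow> 'a set \<Rightarrow> bool" where
  "meagre_in T M \<longleftrightarrow> (\<exists>N :: nat \<Rightarrow> 'a set. (\<forall>i. nowhere_dense_in T (N i)) \<and> M = (\<Union>i. N i))"

definition Baire_property_in :: "'a topology \<Rightarrow> 'a set \<Rightarrow> bool" where
  "Baire_property_in T X \<longleftrightarrow> (\<exists>U M. openin T U \<and> meagre_in T M \<and> X = (U - M) \<union> (M - U))"

definition Ramsey_set :: "nat rel set \<Rightarrow> nat rel set \<Rightarrow> bool" where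
  "Ramsey_set R X \<longleftrightarrow>
     (\<forall>a \<in> approximations R. \<forall>B \<in> R. basic_set R a B \<noteq> {} \<longrightarrow>
        (\<exists>A \<in> basic_set R a B. basic_set R a A \<subseteq> X \<or> basic_set R a A \<inter> X = {}))"

definition Ramsey_null_set :: "nat rel set \<Rightarrow> nat rel set \<Rightarrow> bool" where
  "Ramsey_null_set R X \<longleftrightarrow>
     (\<forall>a \<in> approximations R. \<forall>B \<in> R. basic_set R a B \<noteq> {} \<longrightarrow>
        (\<exists>A \<in> basic_set R a B. basic_set R a A \<inter> X = {}))"

(* The relation and the restriction maps are always coarsening and restr, so the
   predicate takes only the underlying set of the space as an argument. The first
   conjunct records the standing assumption under which class_min is an enumeration. *)
definition topological_Ramsey_space :: "nat rel set \<Rightarrow> bool" where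
  "topological_Ramsey_space R \<longleftrightarrow>
     (\<forall>E \<in> R. equiv UNIV E \<and> infinite (UNIV // E)) \<and>
     (\<forall>X \<subseteq> R. (Baire_property_in (ellentuck R) X \<longleftrightarrow> Ramsey_set R X) \<and>
              (meagre_in (ellentuck R) X \<longleftrightarrow> Ramsey_null_set R X))"

definition coloured_equivs :: "nat \<Rightarrow> (nat \<Rightarrow> nat set) \<Rightarrow> nat rel set" where
  "coloured_equivs l P =
     {E. equiv UNIV E \<and> infinite (UNIV // E) \<and> (\<forall>k. class_min E k \<in> P (k mod l))}"

end

theory Submission
  imports Defs "HOL-Library.Nat_Bijection" "HOL-Number_Theory.Cong"
begin

text \<open>An equivalence relation with infinitely many classes is the kernel of a unique rigid surjection
  \<open>f\<close> on the natural numbers (the classes are numbered by their minima), and coarsening is composition with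
  a rigid surjection \<open>g\<close> from the left. The colour condition on the minima of \<open>f\<close> and \<open>g \<circ> f\<close> says
  exactly that the first occurrence of \<open>k\<close> in \<open>g\<close> is congruent to \<open>k\<close> modulo \<open>l\<close>, so below any point the
  space looks like the monoid \<open>M\<close> of such \<open>g\<close>. With \<open>N n\<close> the submonoid fixing all numbers below \<open>n\<close>,
  the neighbourhoods \<open>[r\<^sub>n f, f]\<close> are the orbits \<open>N (n + 1) \<circ> f\<close>.

  The pigeonhole principle for one-step extensions is then the Carlson-Simpson lemma for words over the
  alphabet of blocks of length \<open>l\<close>. It is proved from the Hales-Jewett theorem by a largeness argument in
  the style of Baumgartner's proof of Hindman's theorem: a set of words is large if it meets every
  subspace, and one shows that a large set contains a whole subspace. Accepting and rejecting
  neighbourhoods, with fusion, gives the Ellentuck dichotomy for open sets.\<close>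

section \<open>The Hales-Jewett theorem\<close>

text \<open>The exchange lemmas \<open>push\<close> and \<open>pull\<close> do what an amalgamation
  axiom does in the abstract theory: shrinking \<open>A\<close> beyond position \<open>j\<close> and
  shrinking \<open>b \<circ> A\<close> beyond \<open>b j\<close> correspond to each other, so
  requirements on the finitely many \<open>b \<in> T j\<close> can be met one by one and then fused.
  The residues matter because a new value \<open>n\<close> may only start at a position congruent to
  \<open>n\<close>. Hence words have lengths divisible by \<open>l\<close>, and the pigeonhole
  construction passes \<open>l\<close> new values at once, from level \<open>n\<close> to level
  \<open>n + l\<close>. The numbers below the level are the letters, so the alphabet grows at every
  step. A word of a subspace stops just before the next fresh variable; allowing one more letter
  \<alpha> turns the word \<open>p\<close> into \<open>p\<close>, then \<alpha>, then an instance of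
  the stretch up to the next fresh variable. This forces a form of the Hales-Jewett theorem in which
  the variable comes directly after \<open>p\<close> and the colour of \<open>p\<close> itself is
  included. The end-marker argument provides it.\<close>

definition words :: "'a set \<Rightarrow> nat \<Rightarrow> 'a list set" where
  "words A n = {w. set w \<subseteq> A \<and> length w = n}"

definition var_word :: "'a set \<Rightarrow> 'a option list \<Rightarrow> bool" where
  "var_word A V \<longleftrightarrow> None \<in> set V \<and> set V \<subseteq> insert None (Some ` A)"

definition fill :: "'a \<Rightarrow> 'a option list \<Rightarrow> 'a list" where
  "fill a V = map (case_option a id) V"

definition fills :: "'a list \<Rightarrow> 'a option list list \<Rightarrow> 'a list" where
  "fills cs Vs = concat (map2 fill cs Vs)"

text \<open>Substituting \<open>None\<close> keeps the variable, so a list of letters and variables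
  can be filled into a list of variable words to give one variable word.\<close>

definition ofill :: "'a option \<Rightarrow> 'a option list \<Rightarrow> 'a option list" where
  "ofill e V = map (case_option e Some) V"

definition ofills :: "'a option list \<Rightarrow> 'a option list list \<Rightarrow> 'a option list" where
  "ofills es Vs = concat (map2 ofill es Vs)"

text \<open>Colours are natural numbers so that vectors of colours can be coded as colours again;
  the palette \<open>C\<close> is quantified inside because the induction passes to larger
  ones.\<close>

definition HJ :: "'a set \<Rightarrow> bool" where
  "HJ A \<longleftrightarrow> (\<forall>C :: nat set. finite C \<longrightarrow> (\<exists>N. \<forall>\<kappa>. \<kappa> ` words A N \<subseteq> C \<longrightarrow>
     (\<exists>V. var_word A V \<and> length V = N \<and> (\<forall>a\<in>A. \<forall>a'\<in>A. \<kappa> (fill a V) = \<kappa> (fill a' V)))))"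

lemma finite_words: "finite A \<Longrightarrow> finite (words A n)"
  unfolding words_def by (rule finite_lists_length_eq)

lemma length_fill [simp]: "length (fill a V) = length V"
  by (simp add: fill_def)

lemma set_fill: "set V \<subseteq> insert None (Some ` A) \<Longrightarrow> a \<in> B \<Longrightarrow> A \<subseteq> B \<Longrightarrow> set (fill a V) \<subseteq> B"
  by (fastforce simp: fill_def split: option.splits)

lemma fill_words: "var_word A V \<Longrightarrow> a \<in> B \<Longrightarrow> A \<subseteq> B \<Longrightarrow> length V = n \<Longrightarrow> fill a V \<in> words B n"
  using set_fill[of V A a B] by (auto simp: words_def var_word_def)

lemma fills_Nil [simp]: "fills [] Vs = []" "fills cs [] = []"
  by (simp_all add: fills_def)

lemma fills_Cons [simp]: "fills (c # cs) (V # Vs) = fill c V @ fills cs Vs"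
  by (simp add: fills_def)

lemma ofills_Nil [simp]: "ofills [] Vs = []" "ofills cs [] = []"
  by (simp_all add: ofills_def)

lemma ofills_Cons [simp]: "ofills (c # cs) (V # Vs) = ofill c V @ ofills cs Vs"
  by (simp add: ofills_def)

lemma fills_words:
  "length cs = length Vs \<Longrightarrow> set cs \<subseteq> B \<Longrightarrow> \<forall>V\<in>set Vs. var_word A V \<Longrightarrow> A \<subseteq> B
   \<Longrightarrow> fills cs Vs \<in> words B (length (concat Vs))"
proof (induction cs Vs rule: list_induct2)
  case (Cons c cs V Vs)
  then show ?case using fill_words[of A V c B "length V"] by (auto simp: words_def)
qed (simp add: words_def)

lemma fill_ofill: "fill x (ofill e V) = fill (case_option x id e) V"
  by (auto simp: fill_def ofill_def split: option.splits)

lemma fill_append: "fill x (U @ V) = fill x U @ fill x V"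
  by (simp add: fill_def)

lemma fill_ofills: "fill x (ofills es Vs) = fills (fill x es) Vs"
proof (induction es arbitrary: Vs)
  case (Cons e es)
  then show ?case
    by (cases Vs) (auto simp: fill_append fill_ofill fill_def[of x "e # es"] fill_def[of x es] fill_def[of x "[]"])
qed (simp add: fill_def)

lemma length_ofills: "length es = length Vs \<Longrightarrow> length (ofills es Vs) = length (concat Vs)"
  by (induction es Vs rule: list_induct2) (auto simp: ofill_def)

lemma ofills_append: "length es = length Us \<Longrightarrow> ofills (es @ es') (Us @ Vs) = ofills es Us @ ofills es' Vs"
  by (simp add: ofills_def)

lemma set_ofills:
  "length es = length Vs \<Longrightarrow> set es \<subseteq> insert None (Some ` B) \<Longrightarrow> \<forall>V\<in>set Vs. var_word A V \<Longrightarrow> A \<subseteq> B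
   \<Longrightarrow> set (ofills es Vs) \<subseteq> insert None (Some ` B)"
proof (induction es Vs rule: list_induct2)
  case (Cons e es V Vs)
  have "set (ofill e V) \<subseteq> insert None (Some ` B)"
  proof
    fix o' assume "o' \<in> set (ofill e V)"
    then obtain v where v: "v \<in> set V" "o' = case_option e Some v" by (auto simp: ofill_def)
    then have "v \<in> insert None (Some ` A)" using Cons.prems unfolding var_word_def by auto
    then have "v = None \<or> v \<in> Some ` B" using Cons.prems by blast
    then show "o' \<in> insert None (Some ` B)" using v Cons.prems by auto
  qed
  then show ?case using Cons by auto
qed simp

lemma None_in_ofills:
  "length es = length Vs \<Longrightarrow> None \<in> set es \<Longrightarrow> \<forall>V\<in>set Vs. var_word A V \<Longrightarrow> None \<in> set (ofills es Vs)"
proof (induction es Vs rule: list_induct2)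
  case (Cons e es V Vs)
  have "e = None \<Longrightarrow> None \<in> set (ofill e V)"
    using Cons.prems by (force simp: ofill_def var_word_def)
  then show ?case using Cons by auto
qed simp

definition sim :: "'a set \<Rightarrow> 'a list \<Rightarrow> 'a list \<Rightarrow> bool" where
  "sim A = list_all2 (\<lambda>c d. c = d \<or> c \<in> A \<and> d \<in> A)"

lemma map_encode_eq:
  "list_encode (map f xs) = list_encode (map g xs) \<Longrightarrow> x \<in> set xs \<Longrightarrow> f x = g x"
  by (metis list_encode_inverse map_eq_conv)

text \<open>The lines use constants from \<open>A\<close> only, so they have no letter of \<open>B - A\<close> of their own:
  this is what lets the same statement serve both for the induction on the alphabet and,
  with an end-marker as extra letter, for words of varying length.\<close>

lemma insensitive_lines:
  fixes A B :: "'a set"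
  assumes HJ: "HJ A" and B: "finite B" "A \<subseteq> B"
  shows "finite (C :: nat set) \<Longrightarrow> \<exists>N. \<forall>\<kappa>. \<kappa> ` words B N \<subseteq> C \<longrightarrow>
    (\<exists>Vs. length Vs = s \<and> (\<forall>V\<in>set Vs. var_word A V) \<and> length (concat Vs) = N \<and>
      (\<forall>cs\<in>words B s. \<forall>ds\<in>words B s. sim A cs ds \<longrightarrow> \<kappa> (fills cs Vs) = \<kappa> (fills ds Vs)))"
proof (induction s arbitrary: C)
  case 0
  show ?case
    by (rule exI[of _ 0]) (auto simp: words_def)
next
  case (Suc s)
  \<comment> \<open>A vector of \<open>n\<close> colours is coded as one number;
    \<open>enc n\<close> is the palette of such vectors.\<close>
  define enc where "enc n = list_encode ` {xs. set xs \<subseteq> C \<and> length xs = n}" for n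
  have fin: "finite (enc n)" for n
    unfolding enc_def using Suc.prems by (intro finite_imageI finite_lists_length_eq)
  obtain cl where cl: "set cl = words B s"
    using finite_list[OF finite_words[OF B(1)]] by blast
  obtain N1 where N1: "\<forall>\<kappa>. \<kappa> ` words A N1 \<subseteq> enc (length cl) \<longrightarrow>
     (\<exists>V. var_word A V \<and> length V = N1 \<and> (\<forall>a\<in>A. \<forall>a'\<in>A. \<kappa> (fill a V) = \<kappa> (fill a' V)))"
    using HJ[unfolded HJ_def, rule_format, OF fin[of "length cl"]] by (elim exE) (rule that)
  obtain tl where tl: "set tl = words B N1"
    using finite_list[OF finite_words[OF B(1)]] by blast
  obtain N2 where N2: "\<forall>\<kappa>. \<kappa> ` words B N2 \<subseteq> enc (length tl) \<longrightarrow>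
    (\<exists>Vs. length Vs = s \<and> (\<forall>V\<in>set Vs. var_word A V) \<and> length (concat Vs) = N2 \<and>
      (\<forall>cs\<in>words B s. \<forall>ds\<in>words B s. sim A cs ds \<longrightarrow> \<kappa> (fills cs Vs) = \<kappa> (fills ds Vs)))"
    using Suc.IH[OF fin[of "length tl"]] by (elim exE) (rule that)
  show ?case
  proof (intro exI[of _ "N1 + N2"] allI impI)
    fix \<kappa> :: "'a list \<Rightarrow> nat" assume \<kappa>: "\<kappa> ` words B (N1 + N2) \<subseteq> C"
    have app: "t @ u \<in> words B (N1 + N2)" if "t \<in> words B N1" "u \<in> words B N2" for t u
      using that by (auto simp: words_def)
    \<comment> \<open>A tail is coloured by the colours it gives to all heads \<open>t\<close>. Once
      \<open>Vs\<close> is fixed, a head is coloured in turn by the colours it gives to all fillings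
      \<open>cs\<close>. The second palette depends only on \<open>words B s\<close>, so
      \<open>N1\<close> could be fixed before \<open>N2\<close>.\<close>
    define \<kappa>2 where "\<kappa>2 u = list_encode (map (\<lambda>t. \<kappa> (t @ u)) tl)" for u
    have "\<kappa>2 ` words B N2 \<subseteq> enc (length tl)"
      using \<kappa> app tl by (fastforce simp: \<kappa>2_def enc_def)
    from N2[rule_format, OF this] obtain Vs where Vs: "length Vs = s" "\<forall>V\<in>set Vs. var_word A V"
      "length (concat Vs) = N2"
      and inv: "\<And>cs ds. cs \<in> words B s \<Longrightarrow> ds \<in> words B s \<Longrightarrow> sim A cs ds \<Longrightarrow>
        \<kappa>2 (fills cs Vs) = \<kappa>2 (fills ds Vs)" by blast
    have fw: "fills cs Vs \<in> words B N2" if "cs \<in> words B s" for cs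
      using fills_words[of cs Vs B A] that Vs B(2) by (auto simp: words_def)
    define \<kappa>1 where "\<kappa>1 t = list_encode (map (\<lambda>cs. \<kappa> (t @ fills cs Vs)) cl)" for t
    have AB: "words A N1 \<subseteq> words B N1" using B(2) by (auto simp: words_def)
    have "\<kappa>1 ` words A N1 \<subseteq> enc (length cl)"
    proof
      fix y assume "y \<in> \<kappa>1 ` words A N1"
      then obtain t where t: "t \<in> words B N1" "y = \<kappa>1 t" using AB by blast
      have "\<kappa> (t @ fills cs Vs) \<in> C" if "cs \<in> set cl" for cs
        using \<kappa> app[OF t(1) fw[of cs]] that cl by blast
      then show "y \<in> enc (length cl)" 
        unfolding t(2) \<kappa>1_def enc_def by (intro imageI) auto
    qed
    from N1[rule_format, OF this] obtain V where V: "var_word A V" "length V = N1"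
      and line: "\<And>a a'. a \<in> A \<Longrightarrow> a' \<in> A \<Longrightarrow> \<kappa>1 (fill a V) = \<kappa>1 (fill a' V)" by blast
    show "\<exists>Vs. length Vs = Suc s \<and> (\<forall>V\<in>set Vs. var_word A V) \<and> length (concat Vs) = N1 + N2 \<and>
      (\<forall>cs\<in>words B (Suc s). \<forall>ds\<in>words B (Suc s). sim A cs ds \<longrightarrow> \<kappa> (fills cs Vs) = \<kappa> (fills ds Vs))"
    proof (intro exI[of _ "V # Vs"] conjI ballI impI)
      fix cs ds assume cd: "cs \<in> words B (Suc s)" "ds \<in> words B (Suc s)" "sim A cs ds"
      then obtain c cs' d ds' where eq: "cs = c # cs'" "ds = d # ds'"
        by (metis (mono_tags, lifting) length_Suc_conv mem_Collect_eq words_def)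
      have m: "cs' \<in> words B s" "ds' \<in> words B s" "c \<in> B" "d \<in> B"
        using cd by (auto simp: eq words_def)
      have s: "sim A cs' ds'" "c = d \<or> c \<in> A \<and> d \<in> A" using cd by (auto simp: eq sim_def)
      have "fill c V \<in> set tl" using fill_words[OF V(1) m(3) B(2) V(2)] tl by simp
      with inv[OF m(1,2) s(1)] have "\<kappa> (fill c V @ fills cs' Vs) = \<kappa> (fill c V @ fills ds' Vs)"
        unfolding \<kappa>2_def by (rule map_encode_eq)
      also have "\<dots> = \<kappa> (fill d V @ fills ds' Vs)"
      proof (cases "c = d")
        case False
        then have "\<kappa>1 (fill c V) = \<kappa>1 (fill d V)" using s(2) line by blast
        from map_encode_eq[OF this[unfolded \<kappa>1_def]] m(2) cl show ?thesis by blast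
      qed simp
      finally show "\<kappa> (fills cs (V # Vs)) = \<kappa> (fills ds (V # Vs))" by (simp add: eq)
    qed (use V Vs in auto)
  qed
qed

lemma pigeonhole_levels:
  fixes f :: "nat \<Rightarrow> nat"
  assumes "finite C" "f ` {..card C} \<subseteq> C"
  obtains i j where "i < j" "j \<le> card C" "f i = f j"
proof -
  have "\<not> inj_on f {..card C}"
    using card_inj_on_le[of f "{..card C}" C] assms by auto
  then show thesis using that
    by (metis atMost_iff inj_onI linorder_neqE_nat)
qed

lemma sim_replicate:
  "a \<in> A \<Longrightarrow> x \<in> A \<Longrightarrow> sim A (us @ replicate n a @ vs) (us @ replicate n x @ vs)"
  by (auto simp: sim_def list_all2_append list_all2_same list_all2_conv_all_nth nth_append)

text \<open>With \<open>s = card C\<close>, two of the \<open>s + 1\<close> points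
  \<open>b^i a^(s-i)\<close> have the same colour, say for \<open>i < j\<close>. Put the variable at
  the positions from \<open>i\<close> to \<open>j - 1\<close>: the letter \<open>b\<close> gives
  point \<open>j\<close>, the letter \<open>a\<close> gives point \<open>i\<close>, and any other
  letter of \<open>A\<close> gives the colour of point \<open>i\<close> by insensitivity.\<close>

lemma HJ_insert:
  assumes HJ: "HJ A" and A: "finite A"
  shows "HJ (insert b A)"
proof (cases "A = {}")
  case True
  show ?thesis unfolding HJ_def True
    by (intro allI impI exI[of _ 1] exI[of _ "[None]"]) (auto simp: var_word_def)
next
  case False
  then obtain a where a: "a \<in> A" by blast
  let ?B = "insert b A"
  show ?thesis unfolding HJ_def
  proof (intro allI impI)
    fix C :: "nat set" assume C: "finite C"
    define s where "s = card C"
    obtain N where N: "\<And>\<kappa>. \<kappa> ` words ?B N \<subseteq> C \<Longrightarrow>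
      \<exists>Vs. length Vs = s \<and> (\<forall>V\<in>set Vs. var_word A V) \<and> length (concat Vs) = N \<and>
      (\<forall>cs\<in>words ?B s. \<forall>ds\<in>words ?B s. sim A cs ds \<longrightarrow> \<kappa> (fills cs Vs) = \<kappa> (fills ds Vs))"
      using insensitive_lines[OF HJ _ _ C, of ?B s] A by blast
    show "\<exists>N. \<forall>\<kappa>. \<kappa> ` words ?B N \<subseteq> C \<longrightarrow> (\<exists>V. var_word ?B V \<and> length V = N \<and>
       (\<forall>a\<in>?B. \<forall>a'\<in>?B. \<kappa> (fill a V) = \<kappa> (fill a' V)))"
    proof (intro exI[of _ N] allI impI)
      fix \<kappa> assume \<kappa>: "\<kappa> ` words ?B N \<subseteq> C"
      from N[OF \<kappa>] obtain Vs where Vs: "length Vs = s" "\<forall>V\<in>set Vs. var_word A V"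
        "length (concat Vs) = N"
        and inv: "\<And>cs ds. cs \<in> words ?B s \<Longrightarrow> ds \<in> words ?B s \<Longrightarrow> sim A cs ds \<Longrightarrow>
          \<kappa> (fills cs Vs) = \<kappa> (fills ds Vs)" by blast
      define pt where "pt i = replicate i b @ replicate (s - i) a" for i
      have "\<kappa> (fills (pt i) Vs) \<in> C" if "i \<le> s" for i
      proof -
        have "set (pt i) \<subseteq> ?B" using a by (auto simp: pt_def)
        then have "fills (pt i) Vs \<in> words ?B N"
          using fills_words[of "pt i" Vs ?B A] Vs that by (auto simp: pt_def)
        then show ?thesis using \<kappa> by blast
      qed
      then have "(\<lambda>i. \<kappa> (fills (pt i) Vs)) ` {..card C} \<subseteq> C" by (auto simp: s_def)
      from pigeonhole_levels[OF C this] obtain i j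
        where ij: "i < j" "j \<le> s" "\<kappa> (fills (pt i) Vs) = \<kappa> (fills (pt j) Vs)"
        unfolding s_def by blast
      define es where "es = replicate i (Some b) @ replicate (j - i) None @ replicate (s - j) (Some a)"
      define q where "q x = replicate i b @ replicate (j - i) x @ replicate (s - j) a" for x
      have q: "fill x (ofills es Vs) = fills (q x) Vs" for x
        by (simp add: fill_ofills) (simp add: es_def q_def fill_def)
      have qb: "q b = pt j" using ij by (simp add: q_def pt_def replicate_add[symmetric] append_assoc[symmetric] del: append_assoc)
      have qa: "q a = pt i" using ij by (simp add: q_def pt_def replicate_add[symmetric])
      have mono: "\<kappa> (fills (q x) Vs) = \<kappa> (fills (pt i) Vs)" if "x \<in> ?B" for x
      proof (cases "x = b")
        case True then show ?thesis using qb ij by simp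
      next
        case False
        then have x: "x \<in> A" using that by simp
        have "q x \<in> words ?B s" "q a \<in> words ?B s" using ij a x by (auto simp: q_def words_def)
        moreover have "sim A (q x) (q a)" unfolding q_def by (rule sim_replicate[OF x a])
        ultimately show ?thesis using inv qa by metis
      qed
      have les: "length es = length Vs" using Vs ij by (simp add: es_def)
      have ses: "set es \<subseteq> insert None (Some ` ?B)" "None \<in> set es"
        using ij a by (auto simp: es_def)
      have "var_word ?B (ofills es Vs)"
        unfolding var_word_def
        using None_in_ofills[OF les ses(2) Vs(2)] set_ofills[OF les ses(1) Vs(2)] by blast
      moreover have "length (ofills es Vs) = N" using length_ofills[OF les] Vs by simp
      ultimately show "\<exists>V. var_word ?B V \<and> length V = N \<and>
          (\<forall>a\<in>?B. \<forall>a'\<in>?B. \<kappa> (fill a V) = \<kappa> (fill a' V))"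
        using mono q by metis
    qed
  qed
qed

theorem Hales_Jewett: "finite A \<Longrightarrow> HJ A"
proof (induction A rule: finite_induct)
  case empty
  show ?case unfolding HJ_def
    by (intro allI impI exI[of _ 1] exI[of _ "[None]"]) (auto simp: var_word_def)
qed (rule HJ_insert)

lemma takeWhile_fill:
  "b \<notin> set (fill x (takeWhile (\<lambda>e. e \<noteq> Some b) E)) \<Longrightarrow>
   takeWhile (\<lambda>c. c \<noteq> b) (fill x E) = fill x (takeWhile (\<lambda>e. e \<noteq> Some b) E)"
  by (induction E) (auto simp: fill_def split: option.splits if_splits)

text \<open>Cutting words over \<open>insert b A\<close> at their first \<open>b\<close> turns a colouring of all words over \<open>A\<close>
  into a colouring of words of fixed length.\<close>

theorem left_variable_word:
  assumes A: "finite A" "A \<noteq> {}" "b \<notin> A" and C: "finite (C :: nat set)" "\<kappa> ` lists A \<subseteq> C"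
  obtains p V where "p \<in> lists A" "set V \<subseteq> insert None (Some ` A)"
    "\<And>x. x \<in> A \<Longrightarrow> \<kappa> (p @ x # fill x V) = \<kappa> p"
proof -
  obtain a where a: "a \<in> A" using A by blast
  let ?B = "insert b A"
  define s where "s = card C"
  let ?cut = "takeWhile (\<lambda>c. c \<noteq> b)"
  obtain N where N: "\<And>\<kappa>. \<kappa> ` words ?B N \<subseteq> C \<Longrightarrow>
    \<exists>Vs. length Vs = s \<and> (\<forall>V\<in>set Vs. var_word A V) \<and> length (concat Vs) = N \<and>
    (\<forall>cs\<in>words ?B s. \<forall>ds\<in>words ?B s. sim A cs ds \<longrightarrow> \<kappa> (fills cs Vs) = \<kappa> (fills ds Vs))"
    using insensitive_lines[OF Hales_Jewett[OF A(1)] _ _ C(1), of ?B s] A by blast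
  have cutA: "set (?cut w) \<subseteq> A" if "set w \<subseteq> ?B" for w
    using that by (induction w) auto
  have \<kappa>: "(\<lambda>w. \<kappa> (?cut w)) ` words ?B N \<subseteq> C"
    using C(2) cutA by (fastforce simp: words_def in_lists_conv_set)
  from N[OF \<kappa>] obtain Vs where Vs: "length Vs = s" "\<forall>V\<in>set Vs. var_word A V"
    "length (concat Vs) = N"
    and inv: "\<And>cs ds. cs \<in> words ?B s \<Longrightarrow> ds \<in> words ?B s \<Longrightarrow> sim A cs ds \<Longrightarrow>
      \<kappa> (?cut (fills cs Vs)) = \<kappa> (?cut (fills ds Vs))" by blast
  \<comment> \<open>Here the new letter \<open>b\<close> stands last, since it marks the end: a
    larger \<open>i\<close> cuts the word later.\<close>
  define pt where "pt i = replicate i a @ replicate (s - i) b" for i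
  have "\<kappa> (?cut (fills (pt i) Vs)) \<in> C" if "i \<le> s" for i
  proof -
    have "fills (pt i) Vs \<in> words ?B N"
    proof -
      have "set (pt i) \<subseteq> ?B" using a by (auto simp: pt_def)
      then show ?thesis using fills_words[of "pt i" Vs ?B A] Vs that by (auto simp: pt_def)
    qed
    then show ?thesis using \<kappa> by blast
  qed
  then have "(\<lambda>i. \<kappa> (?cut (fills (pt i) Vs))) ` {..card C} \<subseteq> C" by (auto simp: s_def)
  from pigeonhole_levels[OF C(1) this] obtain i j
    where ij: "i < j" "j \<le> s" "\<kappa> (?cut (fills (pt i) Vs)) = \<kappa> (?cut (fills (pt j) Vs))"
    unfolding s_def by blast
  define es where "es = replicate i (Some a) @ replicate (j - i) None @ replicate (s - j) (Some b)"
  define q where "q x = replicate i a @ replicate (j - i) x @ replicate (s - j) b" for x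
  define E where "E = ofills es Vs"
  have q: "fill x E = fills (q x) Vs" for x
    by (simp add: E_def fill_ofills) (simp add: es_def q_def fill_def)
  have qa: "q a = pt j" using ij by (simp add: q_def pt_def replicate_add[symmetric] append_assoc[symmetric] del: append_assoc)
  have qb: "q b = pt i" using ij by (simp add: q_def pt_def replicate_add[symmetric])
  have les: "length es = length Vs" using Vs ij by (simp add: es_def)
  define E' where "E' = takeWhile (\<lambda>e. e \<noteq> Some b) E"
  have ses: "set es \<subseteq> insert None (Some ` ?B)"
    using a by (auto simp: es_def)
  have "set E \<subseteq> insert None (Some ` ?B)"
    unfolding E_def using set_ofills[OF les ses Vs(2)] by blast
  then have setE': "set E' \<subseteq> insert None (Some ` A)"
    unfolding E'_def by (induction E) auto
  \<comment> \<open>The constants of \<open>Vs\<close> come from \<open>A\<close>, so a literal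
    \<open>b\<close> can only arise from the lines with index at least \<open>j\<close>. The lines
    with index from \<open>i\<close> to \<open>j - 1\<close> precede them and keep their
    variable.\<close>
  have "None \<in> set E'"
  proof -
    define Us Ws where "Us = take j Vs" and "Ws = drop j Vs"
    have E: "E = ofills (replicate i (Some a) @ replicate (j - i) None) Us
            @ ofills (replicate (s - j) (Some b)) Ws"
      using ofills_append[of "replicate i (Some a) @ replicate (j - i) None" Us
          "replicate (s - j) (Some b)" Ws] ij Vs
      by (simp add: E_def es_def Us_def Ws_def)
    have len: "length (replicate i (Some a) @ replicate (j - i) None) = length Us"
      using ij Vs by (simp add: Us_def)
    have UsV: "\<forall>V\<in>set Us. var_word A V" using Vs by (auto simp: Us_def dest: in_set_takeD)
    have s1: "set (replicate i (Some a) @ replicate (j - i) None) \<subseteq> insert None (Some ` A)"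
      using a by auto
    have s2: "None \<in> set (replicate i (Some a) @ replicate (j - i) None)"
      using ij by auto
    have b': "Some b \<notin> set (ofills (replicate i (Some a) @ replicate (j - i) None) Us)"
      using set_ofills[OF len s1 UsV] A(3) by blast
    have "None \<in> set (ofills (replicate i (Some a) @ replicate (j - i) None) Us)"
      using None_in_ofills[OF len s2 UsV] .
    moreover have "takeWhile (\<lambda>e. e \<noteq> Some b) (us @ ws) = us @ takeWhile (\<lambda>e. e \<noteq> Some b) ws"
      if "Some b \<notin> set us" for us ws using that by (induction us) auto
    ultimately show ?thesis unfolding E'_def E using b' by simp
  qed
  then obtain P V where PV: "E' = P @ None # V" "None \<notin> set P"
    by (meson split_list_first)
  define p where "p = map the P"
  have P: "set P \<subseteq> Some ` A" using setE' PV by auto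
  then have pA: "p \<in> lists A" by (fastforce simp: p_def in_lists_conv_set)
  have fillP: "fill x P = p" for x
    using PV(2) unfolding p_def fill_def by (intro map_cong refl) (auto split: option.splits)
  have cutx: "?cut (fills (q x) Vs) = p @ x # fill x V" if "x \<in> A" for x
  proof -
    have "b \<notin> set (fill x E')" using set_fill[OF setE' that] A(3) by blast
    from takeWhile_fill[OF this[unfolded E'_def]] show ?thesis
      by (simp add: q[symmetric] E'_def[symmetric] PV fill_append fillP) (simp add: fill_def)
  qed
  \<comment> \<open>Filling in the end-marker cuts at the first variable, so point \<open>i\<close>
    stands for the prefix \<open>p\<close> alone.\<close>
  have cutb: "?cut (fills (q b) Vs) = p"
  proof -
    obtain Y where Y: "E = E' @ Y" unfolding E'_def by (metis takeWhile_dropWhile_id)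
    have "fill b E = p @ b # fill b V @ fill b Y"
      by (simp add: Y PV fill_append fillP) (simp add: fill_def)
    moreover have "?cut (p @ b # us) = p" for us
      using pA A(3) by (induction p) auto
    ultimately show ?thesis by (simp add: q[symmetric])
  qed
  have "\<kappa> (p @ x # fill x V) = \<kappa> p" if x: "x \<in> A" for x
  proof -
    have "q x \<in> words ?B s" "q a \<in> words ?B s" using ij a x by (auto simp: q_def words_def)
    moreover have "sim A (q x) (q a)" unfolding q_def by (rule sim_replicate[OF x a])
    ultimately have "\<kappa> (?cut (fills (q x) Vs)) = \<kappa> (?cut (fills (q a) Vs))" by (rule inv)
    then show ?thesis using ij(3) cutx[OF x] cutb by (simp add: qa qb)
  qed
  moreover have "set V \<subseteq> insert None (Some ` A)" using setE' PV by auto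
  ultimately show thesis using that pA by blast
qed

section \<open>The monoid of coloured rigid surjections\<close>

primrec tail_comp :: "(nat \<Rightarrow> nat \<Rightarrow> nat) \<Rightarrow> nat \<Rightarrow> nat \<Rightarrow> nat \<Rightarrow> nat" where
  "tail_comp e i 0 = id"
| "tail_comp e i (Suc m) = e (i + m) \<circ> tail_comp e i m"

lemma tail_comp_shift: "tail_comp e i (Suc m) = tail_comp e (Suc i) m \<circ> e i"
  by (induction m) (auto simp: fun_eq_iff)

text \<open>The cut is at the first occurrence of \<open>m\<close>, inclusive. The continuation with
  slope one makes the finite piece an element of the monoid again, so that finite approximations can
  be composed like any other map.\<close>

definition trunc :: "nat \<Rightarrow> (nat \<Rightarrow> nat) \<Rightarrow> nat \<Rightarrow> nat" where
  "trunc m g = (\<lambda>i. let j = (LEAST x. g x = m) in if i \<le> j then g i else m + (i - j))"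

locale coloured_surjections =
  fixes l :: nat
  assumes l_pos: "1 \<le> l"
begin

text \<open>The colour classes are a parameter so that the space and the monoid \<open>M\<close> are
  instances of one notion. Values before \<open>p\<close> must be smaller than \<open>k\<close>, not
  merely different from it: this numbers the classes by their minima.\<close>

definition rigid :: "(nat \<Rightarrow> nat set) \<Rightarrow> (nat \<Rightarrow> nat) set" where
  "rigid P = {f. \<forall>k. \<exists>p\<in>P (k mod l). f p = k \<and> (\<forall>x<p. f x < k)}"

definition M :: "(nat \<Rightarrow> nat) set" where
  "M = rigid (\<lambda>r. {p. p mod l = r})"

definition N :: "nat \<Rightarrow> (nat \<Rightarrow> nat) set" where
  "N n = {g \<in> M. \<forall>i<n. g i = i}"

definition T :: "nat \<Rightarrow> (nat \<Rightarrow> nat) set" where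
  "T j = {b \<in> M. (\<forall>x<j. b x < b j) \<and> (\<forall>t. b (j + t) = b j + t)}"

text \<open>An element of \<open>T j\<close> is determined by its values up to the first occurrence, at \<open>j\<close>, of \<open>b j\<close>, and
  encodes this finite approximation. An element of \<open>S n\<close> encodes a word over the letters \<open>0, \<dots>, n - 1\<close>
  whose length is a multiple of \<open>l\<close>, written in the positions from \<open>n\<close> to \<open>j - 1\<close>; then \<open>d \<circ> c\<close> is the
  word \<open>c\<close> followed by the word \<open>d\<close>, and \<open>trunc n (c \<circ> k)\<close> is the word \<open>c\<close> substituted into the
  infinite variable word \<open>k \<in> N n\<close>.\<close>

definition S :: "nat \<Rightarrow> (nat \<Rightarrow> nat) set" where
  "S n = {c \<in> N n. \<exists>j. c \<in> T j \<and> c j = n}"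

lemma M_iff: "g \<in> M \<longleftrightarrow> (\<forall>k. \<exists>p. p mod l = k mod l \<and> g p = k \<and> (\<forall>x<p. g x < k))"
  by (auto simp: M_def rigid_def)

lemma MI:
  assumes "\<And>k. \<exists>p. p mod l = k mod l \<and> g p = k \<and> (\<forall>x<p. g x < k)"
  shows "g \<in> M"
  using assms by (simp add: M_iff)

lemma first_occurrence:
  assumes "g \<in> rigid P"
  obtains p where "p \<in> P (k mod l)" "g p = k" "\<And>x. x < p \<Longrightarrow> g x < k" "(LEAST x. g x = k) = p"
proof -
  obtain p where p: "p \<in> P (k mod l)" "g p = k" "\<forall>x<p. g x < k"
    using assms by (auto simp: rigid_def)
  moreover have "(LEAST x. g x = k) = p"
    using p by (intro Least_equality) (auto simp: not_less[symmetric])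
  ultimately show thesis using that by blast
qed

text \<open>Up to the first occurrence of \<open>k\<close> all values are at most \<open>k\<close>,
  so a value above \<open>k\<close> occurs strictly later than some point that is itself at least
  \<open>k\<close> by induction.\<close>

lemma rigid_le: assumes "f \<in> rigid P" shows "f x \<le> x"
proof -
  have "\<forall>x. k \<le> f x \<longrightarrow> k \<le> x" for k
  proof (induction k)
    case (Suc k)
    show ?case
    proof (intro allI impI)
      fix x assume x: "Suc k \<le> f x"
      obtain p where p: "f p = k" "\<And>x. x < p \<Longrightarrow> f x < k"
        using first_occurrence[OF assms, of k] by metis
      have "p < x" using p x by (metis Suc_n_not_le_n less_imp_le linorder_neqE_nat not_less_eq_eq)
      moreover have "k \<le> p" using Suc p by auto
      ultimately show "Suc k \<le> x" by simp
    qed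
  qed simp
  then show ?thesis by blast
qed

lemma M_rigid: "g \<in> M \<Longrightarrow> g \<in> rigid (\<lambda>r. {p. p mod l = r})"
  by (simp add: M_def)

lemma M_le: "g \<in> M \<Longrightarrow> g x \<le> x"
  using rigid_le M_rigid by blast

lemma M_first:
  assumes "g \<in> M"
  obtains p where "p mod l = k mod l" "g p = k" "\<And>x. x < p \<Longrightarrow> g x < k" "(LEAST x. g x = k) = p" "k \<le> p"
proof (rule first_occurrence[OF M_rigid[OF assms], of k])
  fix p assume p: "p \<in> {p. p mod l = k mod l}" "g p = k" "\<And>x. x < p \<Longrightarrow> g x < k" "(LEAST x. g x = k) = p"
  show thesis using that[of p] p M_le[OF assms, of p] by simp
qed

lemma comp_rigid: assumes "g \<in> M" "f \<in> rigid P" shows "g \<circ> f \<in> rigid P"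
  unfolding rigid_def
proof (intro CollectI allI)
  fix k
  obtain p where p: "p mod l = k mod l" "g p = k" "\<And>x. x < p \<Longrightarrow> g x < k"
    using M_first[OF assms(1)] by metis
  obtain q where q: "q \<in> P (p mod l)" "f q = p" "\<And>x. x < q \<Longrightarrow> f x < p"
    using first_occurrence[OF assms(2)] by metis
  then show "\<exists>p\<in>P (k mod l). (g \<circ> f) p = k \<and> (\<forall>x<p. (g \<circ> f) x < k)"
    using p by (intro bexI[of _ q]) auto
qed

lemma comp_M: "g \<in> M \<Longrightarrow> f \<in> M \<Longrightarrow> g \<circ> f \<in> M"
  using comp_rigid unfolding M_def by blast

lemma id_M: "id \<in> M" by (auto simp: M_iff)

lemma NM: "g \<in> N n \<Longrightarrow> g \<in> M" by (simp add: N_def)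

lemma N_fix: "g \<in> N n \<Longrightarrow> i < n \<Longrightarrow> g i = i" by (simp add: N_def)

lemma comp_N: "g \<in> N n \<Longrightarrow> f \<in> N n \<Longrightarrow> g \<circ> f \<in> N n"
  by (simp add: N_def comp_M)

lemma id_N: "id \<in> N n" by (simp add: N_def id_M)

lemma N_mono: "m \<le> n \<Longrightarrow> N n \<subseteq> N m" by (auto simp: N_def)

lemma TM: "b \<in> T j \<Longrightarrow> b \<in> M" by (simp add: T_def)

lemma T_add: "b \<in> T j \<Longrightarrow> b (j + t) = b j + t" by (simp add: T_def)

lemma T_ge: "b \<in> T j \<Longrightarrow> j \<le> x \<Longrightarrow> b x = b j + (x - j)"
  using T_add[of b j "x - j"] by simp

lemma T_less: "b \<in> T j \<Longrightarrow> x < j \<Longrightarrow> b x < b j" by (simp add: T_def)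

lemma T_mono: assumes "b \<in> T j" "j \<le> i" shows "b \<in> T i"
  unfolding T_def
proof (intro CollectI conjI allI impI)
  have i: "b i = b j + (i - j)" using T_ge assms by blast
  show "b x < b i" if "x < i" for x
    using that i T_less[OF assms(1), of x] T_ge[OF assms(1), of x] by (cases "x < j") auto
  show "b (i + t) = b i + t" for t
    using i T_ge[OF assms(1), of "i + t"] assms(2) by auto
qed (use assms TM in auto)

lemma T_first: assumes "b \<in> T j" shows "(LEAST x. b x = b j) = j"
proof (rule Least_equality)
  fix y assume "b y = b j" then show "j \<le> y" using T_less[OF assms, of y] by (metis leI less_irrefl)
qed simp

lemma T_mod: assumes "b \<in> T j" shows "b j mod l = j mod l"
  using M_first[OF TM[OF assms], of "b j"] T_first[OF assms] by metis

lemma id_T: "id \<in> T j" by (simp add: T_def id_M)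

text \<open>The first \<open>j + 1\<close> values are a complete code, because the rest has slope
  one, and they are bounded by \<open>M_le\<close>.\<close>

lemma finite_T: "finite (T j)"
proof -
  have "inj_on (\<lambda>b. map b [0..<Suc j]) (T j)"
  proof (rule inj_onI)
    fix b c assume bc: "b \<in> T j" "c \<in> T j" "map b [0..<Suc j] = map c [0..<Suc j]"
    have eq: "b x = c x" if "x \<le> j" for x
    proof -
      have "\<forall>x\<in>set [0..<Suc j]. b x = c x" using bc(3) unfolding map_eq_conv .
      then show ?thesis using that by (simp del: upt_Suc)
    qed
    show "b = c"
    proof
      fix x
      have "j \<le> x \<Longrightarrow> b x = c x" 
        using T_ge[OF bc(1), of x] T_ge[OF bc(2), of x] eq[of j] by linarith
      then show "b x = c x" using eq[of x] by linarith
    qed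
  qed
  moreover have "finite ((\<lambda>b. map b [0..<Suc j]) ` T j)"
  proof (rule finite_subset)
    show "(\<lambda>b. map b [0..<Suc j]) ` T j \<subseteq> {xs. set xs \<subseteq> {..j} \<and> length xs = Suc j}"
    proof (intro image_subsetI CollectI conjI subsetI)
      fix b v assume b: "b \<in> T j" "v \<in> set (map b [0..<Suc j])"
      then obtain x where "v = b x" "x < Suc j" by (auto simp del: upt_Suc)
      then show "v \<in> {..j}" using M_le[OF TM[OF b(1)], of x] by simp
    qed simp
    show "finite {xs. set xs \<subseteq> {..j} \<and> length xs = Suc j}"
      by (rule finite_lists_length_eq) simp
  qed
  ultimately show ?thesis by (metis finite_imageD)
qed

lemma mod_shift: "(a + t) mod l = (a + s) mod l \<longleftrightarrow> t mod l = s mod (l::nat)"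
  using cong_add_lcancel_nat[of a t s l] by (simp add: cong_def)

lemma T_mod_shift: "b \<in> T j \<Longrightarrow> (b j + s) mod l = (j + s) mod l"
  using T_mod by (metis mod_add_left_eq)

section \<open>Exchanging shrinkings with finite approximations\<close>

text \<open>From \<open>j\<close> on, \<open>b\<close> is a translation, so \<open>k\<close> can be
  read off as \<open>k (b j + t) = g (j + t)\<close>. By \<open>T_mod\<close> the translation
  preserves residues, hence \<open>k\<close> inherits the condition on first occurrences from
  \<open>g\<close>.\<close>

lemma factor:
  assumes b: "b \<in> T j" and g: "g \<in> M" and eq: "\<And>i. i < j \<Longrightarrow> g i = b i"
  obtains k where "k \<in> N (b j)" "g = k \<circ> b"
proof -
  define k where "k i = (if i < b j then i else g (j + (i - b j)))" for i
  have "g = k \<circ> b"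
  proof
    fix x show "g x = (k \<circ> b) x"
      using eq[of x] T_less[OF b, of x] T_ge[OF b, of x] by (cases "x < j") (auto simp: k_def)
  qed
  moreover have "k \<in> M"
  proof (rule MI)
    fix q show "\<exists>p. p mod l = q mod l \<and> k p = q \<and> (\<forall>x<p. k x < q)"
    proof (cases "q < b j")
      case True
      then show ?thesis by (intro exI[of _ q]) (auto simp: k_def)
    next
      case False
      obtain p where p: "p mod l = q mod l" "g p = q" "\<And>x. x < p \<Longrightarrow> g x < q"
        using M_first[OF g] by metis
      have "j \<le> p" using False p(2) eq[of p] T_less[OF b, of p] by (cases "p < j") auto
      then obtain t where t: "p = j + t" using le_Suc_ex by blast
      show ?thesis
      proof (intro exI[of _ "b j + t"] conjI allI impI)
        show "(b j + t) mod l = q mod l" using p t T_mod_shift[OF b] by simp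
        show "k (b j + t) = q" using p t by (simp add: k_def)
        show "k x < q" if "x < b j + t" for x
          using that False p(3)[of "j + (x - b j)"] t by (auto simp: k_def)
      qed
    qed
  qed
  then have "k \<in> N (b j)" by (simp add: N_def k_def)
  ultimately show thesis using that by blast
qed

lemma push:
  assumes "b \<in> T j" "h \<in> N j"
  obtains k where "k \<in> N (b j)" "b \<circ> h = k \<circ> b"
proof (rule factor[OF assms(1) comp_M[OF TM[OF assms(1)] NM[OF assms(2)]]])
  show "(b \<circ> h) i = b i" if "i < j" for i using N_fix[OF assms(2) that] by simp
qed (rule that)

text \<open>From \<open>j\<close> on, \<open>h\<close> chooses a preimage under \<open>b\<close> of
  the value that \<open>k\<close> prescribes: the first one, which lies below \<open>j\<close>, for
  values below \<open>b j\<close>, and the translate otherwise. New values of \<open>h\<close>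
  therefore first occur where those of \<open>k\<close> do, up to the translation.\<close>

lemma pull:
  assumes b: "b \<in> T j" and k: "k \<in> N (b j)"
  obtains h where "h \<in> N j" "b \<circ> h = k \<circ> b"
proof -
  define h where "h x = (if x < j then x else let v = k (b j + (x - j)) in
      if v < b j then (LEAST y. b y = v) else j + (v - b j))" for x
  have pre: "b (LEAST y. b y = v) = v" "(LEAST y. b y = v) < j" if v: "v < b j" for v
  proof -
    obtain p where p: "b p = v" "(LEAST x. b x = v) = p"
      by (rule M_first[OF TM[OF b], of v]) (rule that)
    moreover have "p < j" using p(1) v T_ge[OF b, of p] by (cases "p < j") auto
    ultimately show "b (LEAST y. b y = v) = v" "(LEAST y. b y = v) < j" by auto
  qed
  have "b \<circ> h = k \<circ> b"
  proof
    fix x show "(b \<circ> h) x = (k \<circ> b) x"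
    proof (cases "x < j")
      case True
      then show ?thesis using N_fix[OF k] T_less[OF b True] by (simp add: h_def)
    next
      case False
      then have bx: "b x = b j + (x - j)" using T_ge[OF b, of x] by linarith
      define v where "v = k (b j + (x - j))"
      have "h x = (if v < b j then (LEAST y. b y = v) else j + (v - b j))"
        using False by (simp add: h_def v_def Let_def)
      then have "b (h x) = v"
        using pre(1)[of v] T_add[OF b, of "v - b j"] by (cases "v < b j") auto
      then show ?thesis by (simp add: bx v_def)
    qed
  qed
  moreover have "h \<in> M"
  proof (rule MI)
    fix q show "\<exists>p. p mod l = q mod l \<and> h p = q \<and> (\<forall>x<p. h x < q)"
    proof (cases "q < j")
      case True
      then show ?thesis by (intro exI[of _ q]) (auto simp: h_def)
    next
      case False
      then obtain s where s: "q = j + s" using le_Suc_ex not_less by blast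
      obtain p where p: "p mod l = (b j + s) mod l" "k p = b j + s" "\<And>x. x < p \<Longrightarrow> k x < b j + s"
        using M_first[OF NM[OF k]] by metis
      have "b j \<le> p" using p(2) N_fix[OF k, of p] by (cases "p < b j") auto
      then obtain t where t: "p = b j + t" using le_Suc_ex by blast
      show ?thesis
      proof (intro exI[of _ "j + t"] conjI allI impI)
        have "t mod l = s mod l" using p(1) t by (simp add: mod_shift)
        then show "(j + t) mod l = q mod l" by (simp add: s mod_shift)
        show "h (j + t) = q" using p t by (simp add: h_def s)
        show "h x < q" if x: "x < j + t" for x
        proof (cases "x < j")
          case False
          define v where "v = k (b j + (x - j))"
          have "v < b j + s" unfolding v_def using False x t by (intro p(3)) auto
          moreover have "h x = (if v < b j then (LEAST y. b y = v) else j + (v - b j))"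
            using False by (simp add: h_def v_def Let_def)
          ultimately show ?thesis using pre(2)[of v] by (cases "v < b j") (simp_all add: s)
        qed (simp add: h_def s)
      qed
    qed
  qed
  then have "h \<in> N j" by (simp add: N_def h_def)
  ultimately show thesis using that by blast
qed

section \<open>Truncations and words\<close>

lemma trunc_eq: "g j = m \<Longrightarrow> (\<And>x. x < j \<Longrightarrow> g x < m) \<Longrightarrow> trunc m g = (\<lambda>i. if i \<le> j then g i else m + (i - j))"
proof -
  assume "g j = m" "\<And>x. x < j \<Longrightarrow> g x < m"
  then have "(LEAST x. g x = m) = j" 
    by (intro Least_equality) (metis leI less_irrefl)+
  then show ?thesis by (simp add: trunc_def)
qed

lemma trunc_T: assumes "b \<in> T j" shows "trunc (b j) b = b"
proof
  have "trunc (b j) b = (\<lambda>i. if i \<le> j then b i else b j + (i - j))"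
    using T_less[OF assms] by (rule trunc_eq[OF refl])
  then show "trunc (b j) b i = b i" for i using T_ge[OF assms, of i] by simp
qed

text \<open>\<open>factor\<close> is applied at \<open>Suc j\<close> rather than \<open>j\<close>:
  the map and its truncation still agree at \<open>j\<close>, so the remaining factor
  \<open>k\<close> fixes \<open>m\<close> as well.\<close>

lemma trunc_props:
  assumes g: "g \<in> M"
  obtains j k where "trunc m g \<in> T j" "trunc m g j = m" "m \<le> j" "\<And>i. i \<le> j \<Longrightarrow> trunc m g i = g i"
    "k \<in> N (Suc m)" "g = k \<circ> trunc m g"
proof -
  obtain j where j: "j mod l = m mod l" "g j = m" "\<And>x. x < j \<Longrightarrow> g x < m" "m \<le> j"
    using M_first[OF g] by metis
  define b where "b = trunc m g"
  have b: "b i = (if i \<le> j then g i else m + (i - j))" for i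
    unfolding b_def by (subst trunc_eq[of g j m, OF j(2,3)]) auto
  have "b \<in> M"
  proof (rule MI)
    fix q show "\<exists>p. p mod l = q mod l \<and> b p = q \<and> (\<forall>x<p. b x < q)"
    proof (cases "q \<le> m")
      case True
      obtain p where p: "p mod l = q mod l" "g p = q" "\<And>x. x < p \<Longrightarrow> g x < q"
        using M_first[OF g] by metis
      have "p \<le> j" using p(3)[of j] j(2) True by (meson leD leI)
      then show ?thesis using p by (intro exI[of _ p]) (auto simp: b)
    next
      case False
      then obtain s where s: "q = m + s" "s > 0" by (metis less_imp_add_positive not_le)
      show ?thesis
      proof (intro exI[of _ "j + s"] conjI allI impI)
        show "(j + s) mod l = q mod l" using j(1) s by (metis mod_add_left_eq)
        show "b (j + s) = q" using s by (simp add: b)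
        show "b x < q" if "x < j + s" for x
          using that s j(3)[of x] j(2) by (cases "x < j") (auto simp: b)
      qed
    qed
  qed
  then have bT: "b \<in> T j" using j by (auto simp: T_def b)
  then have bS: "b \<in> T (Suc j)" using T_mono by auto
  have "b (Suc j) = Suc m" by (simp add: b)
  with factor[OF bS g] obtain k where "k \<in> N (Suc m)" "g = k \<circ> b"
    by (metis b less_Suc_eq_le)
  moreover have "b j = m" "\<And>i. i \<le> j \<Longrightarrow> b i = g i" using j(2) by (simp_all add: b)
  ultimately show thesis using that[of j k] bT j(4) unfolding b_def by blast
qed

lemma trunc_comp:
  assumes "k \<in> N (Suc m)" "g \<in> M"
  shows "trunc m (k \<circ> g) = trunc m g"
proof -
  obtain j where j: "g j = m" "\<And>x. x < j \<Longrightarrow> g x < m" using M_first[OF assms(2)] by metis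
  have k: "k (g x) = g x" if "x \<le> j" for x
    using that j N_fix[OF assms(1), of "g x"] by (cases "x = j") (auto simp: less_Suc_eq)
  show ?thesis
    using k j trunc_eq[of g j m, OF j] by (subst trunc_eq[of _ j]) auto
qed

lemma trunc_N: assumes "g \<in> N n" "n \<le> m" shows "trunc m g \<in> N n"
proof -
  obtain j where "trunc m g \<in> T j" "m \<le> j" "\<And>i. i \<le> j \<Longrightarrow> trunc m g i = g i"
    using trunc_props[OF NM[OF assms(1)]] by metis
  then show ?thesis using assms by (auto simp: N_def TM)
qed

lemma trunc_S: assumes "g \<in> N n" shows "trunc n g \<in> S n"
  using trunc_props[OF NM[OF assms], of n] trunc_N[OF assms order_refl] unfolding S_def by blast

lemma trunc_factor:
  assumes "g \<in> M" obtains k where "k \<in> N (Suc m)" "g = k \<circ> trunc m g"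
  using trunc_props[OF assms] by metis

lemma S_T: assumes "c \<in> S n" obtains j where "c \<in> T j" "c j = n" "n \<le> j"
proof -
  obtain j where "c \<in> T j" "c j = n" using assms unfolding S_def by blast
  then show thesis using that M_le[OF TM, of c j j] by simp
qed

lemma SN: "c \<in> S n \<Longrightarrow> c \<in> N n" by (simp add: S_def)
lemma SM: "c \<in> S n \<Longrightarrow> c \<in> M" using SN NM by blast

lemma trunc_S_id: "c \<in> S n \<Longrightarrow> trunc n c = c"
  using S_T trunc_T by metis

lemma trunc_comp_S: "k \<in> N (Suc n) \<Longrightarrow> c \<in> S n \<Longrightarrow> trunc n (k \<circ> c) = c"
  using trunc_comp SM trunc_S_id by metis

lemma id_S: "id \<in> S n" using id_N id_T unfolding S_def by fastforce

lemma comp_T: assumes "b \<in> T j" "x \<in> T i" "x i = j" shows "b \<circ> x \<in> T i"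
  using assms comp_M[OF TM[OF assms(1)] TM[OF assms(2)]] T_less[OF assms(2)] T_less[OF assms(1)]
    T_add[OF assms(2)] T_add[OF assms(1)]
  by (auto simp: T_def)

lemma comp_S: assumes "c \<in> S n" "d \<in> S n" shows "c \<circ> d \<in> S n"
proof -
  obtain i j where c: "c \<in> T i" "c i = n" "n \<le> i" and d: "d \<in> T j" "d j = n" "n \<le> j"
    using S_T assms by metis
  have d': "d \<in> T (j + (i - n))" "d (j + (i - n)) = i"
    using d c T_mono[OF d(1), of "j + (i - n)"] T_add[OF d(1), of "i - n"] by simp_all
  then have "c \<circ> d \<in> T (j + (i - n))" using comp_T[OF c(1)] by blast
  then show ?thesis using comp_N[OF SN[OF assms(1)] SN[OF assms(2)]] d' c unfolding S_def by fastforce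
qed

lemma wordI:
  assumes "\<And>x. x < n \<Longrightarrow> f x = x" "\<And>x. n \<le> x \<Longrightarrow> x < j \<Longrightarrow> f x < n" "\<And>x. j \<le> x \<Longrightarrow> f x = n + (x - j)"
    "n \<le> j" "j mod l = n mod l"
  shows "f \<in> S n" "f \<in> T j" "f j = n"
proof -
  have less: "f x < n" if "x < j" for x using assms(1,2) that by (cases "x < n") auto
  have M: "f \<in> M"
  proof (rule MI)
    fix q show "\<exists>p. p mod l = q mod l \<and> f p = q \<and> (\<forall>x<p. f x < q)"
    proof (cases "q < n")
      case True
      then show ?thesis using assms by (intro exI[of _ q]) auto
    next
      case False
      then obtain s where s: "q = n + s" using le_Suc_ex not_less by blast
      show ?thesis
      proof (intro exI[of _ "j + s"] conjI allI impI)
        show "(j + s) mod l = q mod l" using assms(5) s by (metis mod_add_left_eq)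
        show "f (j + s) = q" using s assms(3) by simp
        show "f x < q" if "x < j + s" for x
          using that s less[of x] assms(3)[of x] by (cases "x < j") auto
      qed
    qed
  qed
  show j: "f j = n" using assms(3)[of j] by simp
  show T: "f \<in> T j" using M less j assms(3) by (auto simp: T_def)
  show "f \<in> S n" using M j T assms(1) by (auto simp: S_def N_def)
qed

section \<open>Infinite compositions and fusion\<close>

text \<open>The infinite composite of \<open>e i\<close>, \<open>e (i + 1)\<close> and so on exists
  pointwise: after \<open>x + 1\<close> steps the image of \<open>x\<close> is at most
  \<open>x\<close>, hence below everything that the later steps move, since they fix all numbers
  below \<nu> of their index.\<close>

lemma limit:
  assumes e: "\<And>i. e i \<in> N (\<nu> i)" and \<nu>: "\<And>i. i \<le> \<nu> i" "mono \<nu>"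
  obtains K where "\<And>i. K i \<in> N (\<nu> i)" "\<And>i. K i = K (Suc i) \<circ> e i"
proof -
  define K where "K i x = tail_comp e i (Suc x) x" for i x
  have tN: "tail_comp e i m \<in> N (\<nu> i)" for i m
  proof (induction m)
    case (Suc m)
    have "e (i + m) \<in> N (\<nu> i)" using e N_mono monoD[OF \<nu>(2), of i "i + m"] by auto
    then show ?case unfolding tail_comp.simps using Suc comp_N by blast
  qed (simp add: id_N[unfolded id_def] id_def)
  have fix_e: "tail_comp e i (m + d) x = tail_comp e i m x" if "tail_comp e i m x < i + m" for i m d x
  proof (induction d)
    case (Suc d)
    have "tail_comp e i m x < \<nu> (i + (m + d))" using that \<nu>(1)[of "i + (m + d)"] by linarith
    then show ?case using Suc N_fix[OF e] by simp
  qed simp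
  have st: "tail_comp e i m x = K i x" if "x < m" for i m x
  proof -
    have "tail_comp e i (Suc x) x < i + Suc x"
      using M_le[OF NM[OF tN], of i "Suc x" x] by simp
    from fix_e[OF this, of "m - Suc x"] that show ?thesis by (simp add: K_def del: tail_comp.simps)
  qed
  have KM: "K i \<in> M" for i
  proof (rule MI)
    fix k
    \<comment> \<open>At stage \<open>Suc k\<close> the value \<open>k\<close> and all smaller
      values are already final, so the first occurrence of \<open>k\<close> survives in the
      limit.\<close>
    obtain p where p: "p mod l = k mod l" "tail_comp e i (Suc k) p = k"
      "\<And>x. x < p \<Longrightarrow> tail_comp e i (Suc k) x < k"
      using M_first[OF NM[OF tN]] by metis
    have "K i x = tail_comp e i (Suc k) x" if "x \<le> p" for x
    proof -
      have "tail_comp e i (Suc k) x \<le> k"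
        using that p(2) p(3)[of x] by (cases "x = p") (simp_all del: tail_comp.simps)
      then have "tail_comp e i (Suc k) x < i + Suc k" by linarith
      from fix_e[OF this, of "Suc x"] show ?thesis using st[of x "Suc k + Suc x" i] by linarith
    qed
    then show "\<exists>p. p mod l = k mod l \<and> K i p = k \<and> (\<forall>x<p. K i x < k)" using p by auto
  qed
  have "K i \<in> N (\<nu> i)" for i using KM tN by (simp add: N_def K_def del: tail_comp.simps)
  moreover have "K i = K (Suc i) \<circ> e i" for i
  proof
    fix x
    have "e i x \<le> x" using M_le[OF NM[OF e]] .
    then have "K (Suc i) (e i x) = tail_comp e (Suc i) (Suc x) (e i x)" by (simp add: st del: tail_comp.simps)
    also have "\<dots> = tail_comp e i (Suc (Suc x)) x" by (subst tail_comp_shift) simp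
    also have "\<dots> = K i x" by (rule st) simp
    finally show "K i x = (K (Suc i) \<circ> e i) x" by simp
  qed
  ultimately show thesis using that by blast
qed

text \<open>The invariant \<open>I\<close> only drives the construction and is not claimed of the
  limit. \<open>Q j\<close> does reach the limit, because everything that happens after stage
  \<open>j\<close> amounts to a single element of \<open>N (Suc j)\<close>.\<close>

lemma fusion:
  assumes start: "I n A"
    and step: "\<And>j A. n \<le> j \<Longrightarrow> I j A \<Longrightarrow> \<exists>h\<in>N j. I (Suc j) (h \<circ> A) \<and> Q j (h \<circ> A)"
    and persist: "\<And>j A h. n \<le> j \<Longrightarrow> I (Suc j) A \<Longrightarrow> Q j A \<Longrightarrow> h \<in> N (Suc j) \<Longrightarrow> Q j (h \<circ> A)"
  obtains h where "h \<in> N n" "\<And>j. n \<le> j \<Longrightarrow> Q j (h \<circ> A)"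
proof -
  have "\<exists>f. \<forall>i. (I (n + i) (f i) \<and> (i = 0 \<longrightarrow> f i = A)) \<and>
      (\<exists>h\<in>N (n + i). f (Suc i) = h \<circ> f i \<and> Q (n + i) (f (Suc i)))"
  proof (rule dependent_nat_choice)
    show "\<exists>x. I (n + 0) x \<and> (0 = 0 \<longrightarrow> x = A)" using start by auto
    fix x i assume "I (n + i) x \<and> (i = 0 \<longrightarrow> x = A)"
    then show "\<exists>y. (I (n + Suc i) y \<and> (Suc i = 0 \<longrightarrow> y = A)) \<and>
        (\<exists>h\<in>N (n + i). y = h \<circ> x \<and> Q (n + i) y)"
      using step[of "n + i" x] by auto
  qed
  then obtain f e where f: "\<And>i. I (n + i) (f i)" "f 0 = A"
    and e: "\<And>i. e i \<in> N (n + i)" "\<And>i. f (Suc i) = e i \<circ> f i" "\<And>i. Q (n + i) (f (Suc i))"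
    by metis
  obtain K where K: "\<And>i. K i \<in> N (n + i)" "\<And>i. K i = K (Suc i) \<circ> e i"
  proof (rule limit[of e "\<lambda>i. n + i"])
    show "mono (\<lambda>i. n + i)" by (simp add: mono_def)
    show "e i \<in> N (n + i)" "i \<le> n + i" for i using e(1) by simp_all
  qed (rule that)
  have Kf: "K 0 \<circ> A = K i \<circ> f i" for i
  proof (induction i)
    case (Suc i)
    then show ?case by (metis K(2) comp_assoc e(2))
  qed (simp add: f)
  have "Q j (K 0 \<circ> A)" if "n \<le> j" for j
  proof -
    define i where "i = j - n"
    have i: "j = n + i" using that by (simp add: i_def)
    have "Q (n + i) (K (Suc i) \<circ> f (Suc i))"
      using f(1)[of "Suc i"] K(1)[of "Suc i"] by (intro persist e(3)) simp_all
    then show ?thesis unfolding Kf[of "Suc i"] i .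
  qed
  moreover have "K 0 \<in> N n" using K(1)[of 0] by simp
  ultimately show thesis by (rule that[rotated])
qed

lemma finite_fusion:
  assumes "finite B" and A: "A \<in> \<C>"
    and closed: "\<And>A h. A \<in> \<C> \<Longrightarrow> h \<in> N j \<Longrightarrow> h \<circ> A \<in> \<C>"
    and persist: "\<And>b A h. b \<in> B \<Longrightarrow> A \<in> \<C> \<Longrightarrow> Q b A \<Longrightarrow> h \<in> N j \<Longrightarrow> Q b (h \<circ> A)"
    and ex: "\<And>b A. b \<in> B \<Longrightarrow> A \<in> \<C> \<Longrightarrow> \<exists>h\<in>N j. Q b (h \<circ> A)"
  shows "\<exists>h\<in>N j. \<forall>b\<in>B. Q b (h \<circ> A)"
  using assms(1) persist ex
proof (induction B rule: finite_induct)
  case empty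
  then show ?case using id_N by blast
next
  case (insert b B)
  have "\<exists>h\<in>N j. \<forall>b\<in>B. Q b (h \<circ> A)"
    by (rule insert.IH) (use insert.prems in blast)+
  then obtain h where h: "h \<in> N j" "\<forall>b\<in>B. Q b (h \<circ> A)" by blast
  have hA: "h \<circ> A \<in> \<C>" using closed[OF A h(1)] .
  obtain k where k: "k \<in> N j" "Q b (k \<circ> (h \<circ> A))"
    using insert.prems(2)[of b "h \<circ> A"] hA by blast
  have "\<forall>b\<in>B. Q b (k \<circ> (h \<circ> A))"
    using insert.prems(1)[of _ "h \<circ> A" k] hA h k by blast
  then show ?case using k comp_N[OF k(1) h(1)] by (metis comp_assoc insert_iff)
qed

text \<open>Stage \<open>j\<close> has only finitely many requirements, one for each
  \<open>b \<in> T j\<close>, and each survives further shrinking in \<open>N j\<close>, so they can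
  be met in succession.\<close>

lemma fusion_T:
  assumes A: "A \<in> \<C>"
    and closed: "\<And>A h. A \<in> \<C> \<Longrightarrow> h \<in> N n \<Longrightarrow> h \<circ> A \<in> \<C>"
    and persist: "\<And>j b A h. b \<in> T j \<Longrightarrow> n \<le> j \<Longrightarrow> A \<in> \<C> \<Longrightarrow> Q j b A \<Longrightarrow> h \<in> N j \<Longrightarrow> Q j b (h \<circ> A)"
    and ex: "\<And>j b A. b \<in> T j \<Longrightarrow> n \<le> j \<Longrightarrow> A \<in> \<C> \<Longrightarrow> \<exists>h\<in>N j. Q j b (h \<circ> A)"
  obtains h where "h \<in> N n" "\<And>j b. n \<le> j \<Longrightarrow> b \<in> T j \<Longrightarrow> Q j b (h \<circ> A)"
proof -
  obtain h where "h \<in> N n" "\<And>j. n \<le> j \<Longrightarrow> (\<forall>b\<in>T j. Q j b (h \<circ> A))"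
  proof (rule fusion[of "\<lambda>j A. A \<in> \<C>" n A "\<lambda>j A. \<forall>b\<in>T j. Q j b A"])
    fix j A assume j: "n \<le> j" and A: "A \<in> \<C>"
    have cl: "h \<circ> A \<in> \<C>" if "A \<in> \<C>" "h \<in> N j" for A h
      using closed[of A h] that N_mono[OF j] by blast
    have "\<exists>h\<in>N j. \<forall>b\<in>T j. Q j b (h \<circ> A)"
      using finite_fusion[where Q = "Q j" and j = j, OF finite_T A cl] persist ex j by blast
    then show "\<exists>h\<in>N j. h \<circ> A \<in> \<C> \<and> (\<forall>b\<in>T j. Q j b (h \<circ> A))"
      using cl[OF A] by blast
  next
    fix j A h assume j: "n \<le> j" and A: "A \<in> \<C>" and Q: "\<forall>b\<in>T j. Q j b A" and h: "h \<in> N (Suc j)"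
    have "h \<in> N j" using h N_mono[of j "Suc j"] by auto
    then show "\<forall>b\<in>T j. Q j b (h \<circ> A)" using persist[OF _ j A] Q by blast
  qed (use A in blast)+
  then show thesis using that by blast
qed

subsection \<open>The Carlson-Simpson lemma\<close>

text \<open>One letter is a block of \<open>l\<close> values below \<open>n\<close>, written at the
  positions from \<open>n\<close> to \<open>n + l - 1\<close>; it is coded as the word consisting of
  this block.\<close>

definition letters :: "nat \<Rightarrow> (nat \<Rightarrow> nat) set" where
  "letters n = {\<sigma> \<in> S n. \<sigma> \<in> T (n + l) \<and> \<sigma> (n + l) = n}"

definition large :: "nat \<Rightarrow> (nat \<Rightarrow> nat) set \<Rightarrow> bool" where
  "large n Z \<longleftrightarrow> (\<forall>k\<in>N n. \<exists>c\<in>S n. trunc n (c \<circ> k) \<in> Z)"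

text \<open>The values from \<open>n\<close> to \<open>n + l - 1\<close> act as one block of
  variables: \<open>trunc n v\<close> is the part before the first variable, and composing a letter
  with \<open>v\<close> substitutes it for the block.\<close>

definition variable_words :: "nat \<Rightarrow> (nat \<Rightarrow> nat) set" where
  "variable_words n = {v \<in> N n. \<exists>j. v \<in> T j \<and> v j = n + l}"

text \<open>A one-letter word of level \<open>n + l\<close>: a letter of level \<open>n\<close> is
  kept as a constant, while \<open>\<sigma> = id\<close> gives the block of variables
  itself.\<close>

definition lift :: "nat \<Rightarrow> (nat \<Rightarrow> nat) \<Rightarrow> nat \<Rightarrow> nat" where
  "lift n \<sigma> x = (if x < n + l then x else if x < n + 2 * l then \<sigma> (x - l) else x - l)"

definition word_map :: "(nat \<Rightarrow> nat) list \<Rightarrow> nat \<Rightarrow> nat" where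
  "word_map w = fold (\<circ>) w id"

definition var_map :: "nat \<Rightarrow> (nat \<Rightarrow> nat) option list \<Rightarrow> nat \<Rightarrow> nat" where
  "var_map n V = word_map (map (\<lambda>e. lift n (case_option id id e)) V)"

lemma S_reach:
  assumes "x \<in> S n" "n \<le> i" obtains j where "x \<in> T j" "x j = i" "i \<le> j"
proof -
  obtain j where j: "x \<in> T j" "x j = n" "n \<le> j" using S_T[OF assms(1)] by blast
  show thesis
    using that[of "j + (i - n)"] T_mono[OF j(1), of "j + (i - n)"] T_add[OF j(1), of "i - n"] j assms(2)
    by simp
qed

lemma letter_facts:
  assumes "\<sigma> \<in> letters n"
  shows "x < n \<Longrightarrow> \<sigma> x = x" "x < n + l \<Longrightarrow> \<sigma> x < n" "n + l \<le> x \<Longrightarrow> \<sigma> x = x - l"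
proof -
  have \<sigma>: "\<sigma> \<in> N n" "\<sigma> \<in> T (n + l)" "\<sigma> (n + l) = n" using assms SN by (auto simp: letters_def)
  show "x < n \<Longrightarrow> \<sigma> x = x" using N_fix[OF \<sigma>(1)] .
  show "x < n + l \<Longrightarrow> \<sigma> x < n" using T_less[OF \<sigma>(2), of x] \<sigma>(3) by simp
  show "n + l \<le> x \<Longrightarrow> \<sigma> x = x - l" using T_ge[OF \<sigma>(2), of x] \<sigma>(3) by linarith
qed

lemma letterI:
  assumes "\<And>x. x < n \<Longrightarrow> \<sigma> x = x" "\<And>x. n \<le> x \<Longrightarrow> x < n + l \<Longrightarrow> \<sigma> x < n" "\<And>x. n + l \<le> x \<Longrightarrow> \<sigma> x = x - l"
  shows "\<sigma> \<in> letters n"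
proof -
  have "\<sigma> x = n + (x - (n + l))" if "n + l \<le> x" for x using assms(3)[OF that] that by linarith
  from wordI[of n \<sigma> "n + l", OF assms(1,2) this] show ?thesis by (simp add: letters_def)
qed

lemma letters_S: "\<sigma> \<in> letters n \<Longrightarrow> \<sigma> \<in> S n" by (simp add: letters_def)

lemma finite_letters: "finite (letters n)"
  using finite_subset[OF _ finite_T[of "n + l"]] by (auto simp: letters_def)

lemma letters_nonempty: "1 \<le> n \<Longrightarrow> letters n \<noteq> {}"
  using letterI[of n "\<lambda>x. if x < n then x else if x < n + l then 0 else x - l"] by auto

text \<open>Letters are functions here; the zero function serves as the end-marker in
  \<open>left_variable_word\<close>.\<close>

lemma zero_not_letter: "(\<lambda>_. 0) \<notin> letters n"
  using letter_facts(3)[of "\<lambda>_. 0" n "Suc (n + l)"] by auto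

lemma letter_comp_lift:
  assumes a: "\<alpha> \<in> letters n" and \<sigma>: "\<sigma> \<in> letters n \<or> \<sigma> = id"
  shows "\<alpha> \<circ> lift n \<sigma> = (if \<sigma> = id then \<alpha> else \<sigma>) \<circ> \<alpha>"
proof
  fix x
  have \<sigma>': "(if \<sigma> = id then \<alpha> else \<sigma>) \<in> letters n" (is "?\<sigma> \<in> _") using assms by auto
  consider "x < n + l" | "n + l \<le> x" "x < n + 2 * l" | "n + 2 * l \<le> x" by linarith
  then show "(\<alpha> \<circ> lift n \<sigma>) x = (?\<sigma> \<circ> \<alpha>) x"
  proof cases
    case 1
    then show ?thesis
      using letter_facts(1)[OF \<sigma>', of "\<alpha> x"] letter_facts(2)[OF a 1] by (simp add: lift_def)
  next
    case 2
    have "\<alpha> x = x - l" using letter_facts(3)[OF a, of x] 2 by simp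
    moreover have "\<sigma> \<noteq> id \<Longrightarrow> \<alpha> (\<sigma> (x - l)) = \<sigma> (x - l)"
    proof -
      assume "\<sigma> \<noteq> id"
      then have "\<sigma> (x - l) < n" using \<sigma> letter_facts(2)[of \<sigma> n "x - l"] 2 by auto
      then show ?thesis using letter_facts(1)[OF a] by blast
    qed
    ultimately show ?thesis using 2 by (auto simp: lift_def)
  next
    case 3
    then show ?thesis
      using letter_facts(3)[OF a, of x] letter_facts(3)[OF a, of "x - l"] letter_facts(3)[OF \<sigma>', of "x - l"]
      by (simp add: lift_def)
  qed
qed

lemma lift_S:
  assumes "\<sigma> \<in> letters n \<or> \<sigma> = id" shows "lift n \<sigma> \<in> S (n + l)"
proof (rule wordI[of "n + l" _ "n + 2 * l"])
  fix x assume x: "n + l \<le> x" "x < n + 2 * l"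
  have "x - l < n + l" using x by linarith
  then have "\<sigma> (x - l) < n + l"
    using assms letter_facts(2)[of \<sigma> n "x - l"] x l_pos by (cases "\<sigma> = id") auto
  then show "lift n \<sigma> x < n + l" using x by (simp add: lift_def)
qed (auto simp: lift_def)

lemma word_map_Nil [simp]: "word_map [] = id" by (simp add: word_map_def)

lemma word_map_snoc: "word_map (w @ [c]) = c \<circ> word_map w"
  by (simp add: word_map_def)

lemma word_map_append: "word_map (u @ v) = word_map v \<circ> word_map u"
  by (induction v rule: rev_induct) (simp_all add: word_map_snoc comp_assoc flip: append_assoc)

lemma word_map_S: "set w \<subseteq> S n \<Longrightarrow> word_map w \<in> S n"
  by (induction w rule: rev_induct) (auto simp: word_map_snoc intro: comp_S id_S simp del: o_apply)

text \<open>Substitution passes through the word letter by letter. The \<alpha> that remains on the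
  right is the letter read first: it fills the leading block of variables, which
  \<open>var_map\<close> leaves fixed.\<close>

lemma letter_comp_var_map:
  assumes "\<alpha> \<in> letters n" "set V \<subseteq> insert None (Some ` letters n)"
  shows "\<alpha> \<circ> var_map n V = word_map (fill \<alpha> V) \<circ> \<alpha>"
  using assms(2)
proof (induction V rule: rev_induct)
  case Nil
  then show ?case by (simp add: var_map_def fill_def)
next
  case (snoc e V)
  define \<sigma> where "\<sigma> = case_option id id e"
  have id: "id \<notin> letters n" using letter_facts(2)[of id n n] l_pos by auto
  have "\<sigma> \<in> letters n \<or> \<sigma> = id" using snoc.prems by (auto simp: \<sigma>_def)
  from letter_comp_lift[OF assms(1) this]
  have 1: "\<alpha> \<circ> lift n \<sigma> = case_option \<alpha> id e \<circ> \<alpha>"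
    using snoc.prems id by (cases e) (auto simp: \<sigma>_def)
  have "\<alpha> \<circ> var_map n (V @ [e]) = (\<alpha> \<circ> lift n \<sigma>) \<circ> var_map n V"
    by (simp add: var_map_def word_map_snoc \<sigma>_def comp_assoc)
  also have "\<dots> = case_option \<alpha> id e \<circ> (\<alpha> \<circ> var_map n V)" unfolding 1 by (simp add: comp_assoc)
  also have "\<alpha> \<circ> var_map n V = word_map (fill \<alpha> V) \<circ> \<alpha>"
    by (rule snoc.IH) (use snoc.prems in simp)
  also have "case_option \<alpha> id e \<circ> (word_map (fill \<alpha> V) \<circ> \<alpha>) = word_map (fill \<alpha> (V @ [e])) \<circ> \<alpha>"
    by (simp add: fill_def word_map_snoc comp_assoc)
  finally show ?case .
qed

lemma var_map_S:
  assumes "set V \<subseteq> insert None (Some ` letters n)" shows "var_map n V \<in> S (n + l)"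
  unfolding var_map_def
proof (rule word_map_S)
  show "set (map (\<lambda>e. lift n (case_option id id e)) V) \<subseteq> S (n + l)"
    using assms by (auto intro!: lift_S split: option.splits)
qed

text \<open>The left variable word given by \<open>p\<close> and \<open>V\<close> becomes
  \<open>var_map n V \<circ> word_map p\<close>. Its leading variable needs no letter of its own,
  since elements of \<open>S (n + l)\<close> fix the numbers from \<open>n\<close> to
  \<open>n + l - 1\<close>.\<close>

lemma one_variable:
  assumes n: "1 \<le> n" and C: "finite (C :: nat set)" "\<kappa> ` S n \<subseteq> C"
  obtains v where "v \<in> variable_words n" "\<And>\<alpha>. \<alpha> \<in> letters n \<Longrightarrow> \<kappa> (\<alpha> \<circ> v) = \<kappa> (trunc n v)"
proof -
  have "(\<lambda>w. \<kappa> (word_map w)) ` lists (letters n) \<subseteq> C"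
    using C(2) word_map_S letters_S by (fastforce simp: in_lists_conv_set)
  then obtain p V where p: "p \<in> lists (letters n)" and V: "set V \<subseteq> insert None (Some ` letters n)"
    and mono: "\<And>\<alpha>. \<alpha> \<in> letters n \<Longrightarrow> \<kappa> (word_map (p @ \<alpha> # fill \<alpha> V)) = \<kappa> (word_map p)"
    using left_variable_word[OF finite_letters letters_nonempty[OF n] zero_not_letter C(1)] by blast
  define v where "v = var_map n V \<circ> word_map p"
  have pS: "word_map p \<in> S n" using p letters_S by (intro word_map_S) auto
  have VS: "var_map n V \<in> S (n + l)" using var_map_S[OF V] .
  then have VN: "var_map n V \<in> N (Suc n)" using SN N_mono[of "Suc n" "n + l"] l_pos by auto
  have cut: "trunc n v = word_map p" unfolding v_def using trunc_comp_S[OF VN pS] .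
  have fl: "\<alpha> \<circ> v = word_map (p @ \<alpha> # fill \<alpha> V)" if "\<alpha> \<in> letters n" for \<alpha>
  proof -
    have "\<alpha> \<circ> v = (\<alpha> \<circ> var_map n V) \<circ> word_map p" by (simp add: v_def comp_assoc)
    also have "\<dots> = word_map (fill \<alpha> V) \<circ> \<alpha> \<circ> word_map p"
      using letter_comp_var_map[OF that V] by simp
    also have "\<dots> = word_map ((p @ [\<alpha>]) @ fill \<alpha> V)"
      unfolding word_map_append[of "p @ [\<alpha>]"] word_map_snoc by (simp add: comp_assoc)
    finally show ?thesis by simp
  qed
  have "v \<in> variable_words n"
  proof -
    obtain i where i: "var_map n V \<in> T i" "var_map n V i = n + l" "n + l \<le> i" using S_T[OF VS] by blast
    obtain j where j: "word_map p \<in> T j" "word_map p j = i" "i \<le> j" using S_reach[OF pS, of i] i by auto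
    have "v \<in> T j" unfolding v_def by (rule comp_T[OF i(1) j(1,2)])
    moreover have "v j = n + l" using i j by (simp add: v_def)
    moreover have "v \<in> N n" unfolding v_def
      using comp_N[OF _ SN[OF pS]] VN N_mono[of n "Suc n"] by (simp add: subset_iff)
    ultimately show ?thesis by (auto simp: variable_words_def)
  qed
  then show thesis using that[of v] mono fl cut by simp
qed

text \<open>One \<open>h\<close> serves all \<open>c\<close> at once: it writes the word
  \<open>u\<close> at position \<open>j\<close>, using only letters below \<open>n\<close>, and
  these are fixed by every \<open>c\<close>.\<close>

lemma insert_word:
  assumes u: "u \<in> S n"
  obtains h where "h \<in> S j" "\<And>c. c \<in> N n \<Longrightarrow> c \<in> T j \<Longrightarrow> c j = n \<Longrightarrow> n \<le> j \<Longrightarrow> c \<circ> h = u \<circ> c"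
proof (cases "n \<le> j")
  case False
  then show thesis using that[of id] id_S by auto
next
  case True
  obtain i where i: "u \<in> T i" "u i = n" "n \<le> i" using S_T[OF u] by blast
  have uN: "u \<in> N n" using SN[OF u] .
  define h where "h x = (if x < j then x else if x < j + (i - n) then u (n + (x - j)) else x - (i - n))" for x
  have u1: "u (n + (x - j)) < n" if "j \<le> x" "x < j + (i - n)" for x
    using T_less[OF i(1), of "n + (x - j)"] i that by simp
  have "h \<in> S j"
  proof (rule wordI[of j h "j + (i - n)"])
    show "h x < j" if "j \<le> x" "x < j + (i - n)" for x using u1[OF that] that True by (simp add: h_def)
    have "i mod l = n mod l" using T_mod[OF i(1)] i(2) by simp
    then have "(n + (i - n)) mod l = (n + 0) mod l" using i(3) by simp
    then have "(i - n) mod l = 0 mod l" unfolding mod_shift .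
    then show "(j + (i - n)) mod l = j mod l" using mod_shift[of j "i - n" 0] by simp
  qed (auto simp: h_def)
  moreover have "c \<circ> h = u \<circ> c" if c: "c \<in> N n" "c \<in> T j" "c j = n" for c
  proof
    fix x
    consider "x < j" | "j \<le> x" "x < j + (i - n)" | "j + (i - n) \<le> x" by linarith
    then show "(c \<circ> h) x = (u \<circ> c) x"
    proof cases
      case 1
      then show ?thesis using T_less[OF c(2) 1] c(3) N_fix[OF uN, of "c x"] by (simp add: h_def)
    next
      case 2
      then show ?thesis using T_ge[OF c(2) 2(1)] c(3) N_fix[OF c(1) u1[OF 2]] by (simp add: h_def)
    next
      case 3
      have "c (x - (i - n)) = n + (x - (i - n) - j)" using T_ge[OF c(2), of "x - (i - n)"] c(3) 3 by simp
      moreover have "c x = n + (x - j)" using T_ge[OF c(2), of x] c(3) 3 by simp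
      moreover have "u (n + (x - j)) = n + (n + (x - j) - i)" using T_ge[OF i(1), of "n + (x - j)"] i 3 by simp
      moreover have "h x = x - (i - n)" using 3 by (simp add: h_def)
      moreover have "x - (i - n) - j = n + (x - j) - i" using 3 i(3) by linarith
      ultimately show ?thesis by simp
    qed
  qed
  ultimately show thesis using that by blast
qed

text \<open>Otherwise one builds an infinite variable word, inserting in front of each new variable a word that
  keeps all finitely many substitutions so far outside \<open>Z\<close>.\<close>

lemma large_finite_prefixes:
  assumes "large n Z"
  shows "\<exists>F. finite F \<and> F \<subseteq> S n \<and> (\<forall>u\<in>S n. \<exists>x\<in>F. u \<circ> x \<in> Z)"
proof (rule ccontr)
  assume neg: "\<nexists>F. finite F \<and> F \<subseteq> S n \<and> (\<forall>u\<in>S n. \<exists>x\<in>F. u \<circ> x \<in> Z)"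
  obtain h where h: "h \<in> N n"
    and Q: "\<And>j. n \<le> j \<Longrightarrow> \<forall>c\<in>T j. c \<in> N n \<longrightarrow> c j = n \<longrightarrow> trunc n (c \<circ> (h \<circ> id)) \<notin> Z"
  \<comment> \<open>By the invariant, \<open>A\<close> is a finite word in the values below
    \<open>j\<close> with a tail of slope one. This puts each instance \<open>c \<circ> A\<close>
    into \<open>S n\<close>; of the limit only the second family of conditions is kept.\<close>
  proof (rule fusion[of "\<lambda>j A. A \<in> N n \<and> (\<exists>J. A \<in> T J \<and> A J = j)" n id
        "\<lambda>j A. \<forall>c\<in>T j. c \<in> N n \<longrightarrow> c j = n \<longrightarrow> trunc n (c \<circ> A) \<notin> Z"])
    show "id \<in> N n \<and> (\<exists>J. id \<in> T J \<and> id J = n)" using id_N id_T by auto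
  next
    fix j A assume j: "n \<le> j" and "A \<in> N n \<and> (\<exists>J. A \<in> T J \<and> A J = j)"
    then obtain J where A: "A \<in> N n" "A \<in> T J" "A J = j" by blast
    define F where "F = (\<lambda>c. c \<circ> A) ` {c \<in> T j. c \<in> N n \<and> c j = n}"
    have cA: "c \<circ> A \<in> S n" if "c \<in> T j" "c \<in> N n" "c j = n" for c
    proof -
      have "c \<circ> A \<in> T J" using comp_T[OF that(1) A(2,3)] .
      moreover have "(c \<circ> A) J = n" using A that by simp
      ultimately show ?thesis using comp_N[OF that(2) A(1)] unfolding S_def by blast
    qed
    have "finite F" unfolding F_def using finite_T[of j] by simp
    moreover have "F \<subseteq> S n" using cA by (auto simp: F_def simp del: o_apply)
    moreover have "\<not> (finite F \<and> F \<subseteq> S n \<and> (\<forall>u\<in>S n. \<exists>x\<in>F. u \<circ> x \<in> Z))"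
      using neg by (rule contrapos_nn) (rule exI)
    \<comment> \<open>The assumption is applied to the finite set of all instances of
      \<open>A\<close>, so one \<open>u\<close> is bad for all of them, and
      \<open>insert_word\<close> places it behind \<open>A\<close>.\<close>
    ultimately obtain u where u: "u \<in> S n" "\<And>x. x \<in> F \<Longrightarrow> u \<circ> x \<notin> Z" by blast
    obtain g where g: "g \<in> S j" "\<And>c. c \<in> N n \<Longrightarrow> c \<in> T j \<Longrightarrow> c j = n \<Longrightarrow> n \<le> j \<Longrightarrow> c \<circ> g = u \<circ> c"
      using insert_word[OF u(1)] by blast
    have gN: "g \<in> N j" using SN[OF g(1)] .
    have "trunc n (c \<circ> (g \<circ> A)) \<notin> Z" if c: "c \<in> T j" "c \<in> N n" "c j = n" for c
    proof -
      have "c \<circ> (g \<circ> A) = (c \<circ> g) \<circ> A" by (simp add: comp_assoc)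
      also have "\<dots> = u \<circ> (c \<circ> A)" unfolding g(2)[OF c(2,1,3) j] by (simp add: comp_assoc)
      finally have eq: "c \<circ> (g \<circ> A) = u \<circ> (c \<circ> A)" .
      have "c \<circ> A \<in> F" using c by (auto simp: F_def simp del: o_apply)
      then show ?thesis unfolding eq trunc_S_id[OF comp_S[OF u(1) cA[OF c]]] by (rule u(2))
    qed
    moreover have "g \<circ> A \<in> N n" using comp_N[of g n A] gN N_mono[OF j] A(1) by blast
    moreover have "\<exists>J. g \<circ> A \<in> T J \<and> (g \<circ> A) J = Suc j"
    proof -
      obtain i where i: "g \<in> T i" "g i = j" "j \<le> i" using S_T[OF g(1)] by blast
      have A': "A \<in> T (J + (i - j))" "A (J + (i - j)) = i"
        using T_mono[OF A(2), of "J + (i - j)"] T_add[OF A(2), of "i - j"] A(3) i(3) by simp_all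
      have gA: "g \<circ> A \<in> T (J + (i - j))" using comp_T[OF i(1) A'] .
      moreover have "(g \<circ> A) (J + (i - j)) = j" using A' i by simp
      ultimately have "(g \<circ> A) (Suc (J + (i - j))) = Suc j" using T_add[OF gA, of 1] by simp
      then show ?thesis using T_mono[OF gA, of "Suc (J + (i - j))"] by auto
    qed
    ultimately show "\<exists>h\<in>N j. (h \<circ> A \<in> N n \<and> (\<exists>J. h \<circ> A \<in> T J \<and> (h \<circ> A) J = Suc j)) \<and>
        (\<forall>c\<in>T j. c \<in> N n \<longrightarrow> c j = n \<longrightarrow> trunc n (c \<circ> (h \<circ> A)) \<notin> Z)"
      using gN by blast
  next
    fix j A h assume A: "A \<in> N n \<and> (\<exists>J. A \<in> T J \<and> A J = Suc j)"
      and Q: "\<forall>c\<in>T j. c \<in> N n \<longrightarrow> c j = n \<longrightarrow> trunc n (c \<circ> A) \<notin> Z" and h: "h \<in> N (Suc j)"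
    show "\<forall>c\<in>T j. c \<in> N n \<longrightarrow> c j = n \<longrightarrow> trunc n (c \<circ> (h \<circ> A)) \<notin> Z"
    proof (intro ballI impI)
      fix c assume c: "c \<in> T j" "c \<in> N n" "c j = n"
      have "c (Suc j) = Suc n" using T_add[OF c(1), of 1] c(3) by simp
      then obtain k where k: "k \<in> N (Suc n)" "c \<circ> h = k \<circ> c"
        using push[OF T_mono[OF c(1), of "Suc j"] h] by auto
      have "c \<circ> (h \<circ> A) = (c \<circ> h) \<circ> A" by (simp add: comp_assoc)
      also have "\<dots> = k \<circ> (c \<circ> A)" unfolding k(2) by (simp add: comp_assoc)
      finally have "trunc n (c \<circ> (h \<circ> A)) = trunc n (c \<circ> A)"
        using trunc_comp[OF k(1) comp_M[OF TM[OF c(1)] NM]] A by auto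
      then show "trunc n (c \<circ> (h \<circ> A)) \<notin> Z" using Q c by simp
    qed
  qed blast
  obtain c where c: "c \<in> S n" "trunc n (c \<circ> h) \<in> Z" using assms h unfolding large_def by blast
  obtain j where "c \<in> T j" "c j = n" "n \<le> j" using S_T[OF c(1)] by blast
  then show False using Q[of j] c SN by auto
qed

lemma variable_words_letter:
  assumes "v \<in> variable_words n" "\<alpha> \<in> letters n" shows "\<alpha> \<circ> v \<in> S n"
proof -
  obtain j where j: "v \<in> N n" "v \<in> T j" "v j = n + l" using assms(1) by (auto simp: variable_words_def)
  have "\<alpha> \<circ> v \<in> T j" using comp_T[of \<alpha> "n + l" v j] assms(2) j by (simp add: letters_def)
  moreover have "(\<alpha> \<circ> v) j = n" using assms(2) j by (simp add: letters_def)
  ultimately show ?thesis using comp_N[OF SN[OF letters_S[OF assms(2)]] j(1)] unfolding S_def by blast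
qed

lemma trunc_trunc:
  assumes "g \<in> M" "h \<in> M" shows "trunc n (trunc n g \<circ> h) = trunc n (g \<circ> h)"
proof -
  obtain k where k: "k \<in> N (Suc n)" "g = k \<circ> trunc n g" using trunc_factor[OF assms(1)] by blast
  have "trunc n g \<circ> h \<in> M" using trunc_props[OF assms(1), of n] TM comp_M assms(2) by metis
  from trunc_comp[OF k(1) this] show ?thesis by (metis comp_assoc k(2))
qed

text \<open>Colour a word \<open>u\<close> by some prefix from the finite set \<open>F\<close> that
  carries it into \<open>Z\<close>. A variable word on which this colour is constant needs one
  prefix \<open>x\<close> for all its instances, and \<open>x\<close> followed by that variable word
  is the required one.\<close>

lemma large_variable_word:
  assumes n: "1 \<le> n" and Z: "large n Z"
  obtains v where "v \<in> variable_words n" "trunc n v \<in> Z" "\<And>\<alpha>. \<alpha> \<in> letters n \<Longrightarrow> trunc n (\<alpha> \<circ> v) \<in> Z"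
proof -
  obtain F where F: "finite F" "F \<subseteq> S n" "\<And>u. u \<in> S n \<Longrightarrow> \<exists>x\<in>F. u \<circ> x \<in> Z"
    using large_finite_prefixes[OF Z] by blast
  obtain enc :: "(nat \<Rightarrow> nat) \<Rightarrow> nat" where enc: "inj_on enc F"
    using finite_imp_inj_to_nat_seg[OF F(1)] by blast
  define pick where "pick u = (SOME x. x \<in> F \<and> u \<circ> x \<in> Z)" for u
  have pick: "pick u \<in> F" "u \<circ> pick u \<in> Z" if "u \<in> S n" for u
    using someI_ex[of "\<lambda>x. x \<in> F \<and> u \<circ> x \<in> Z"] F(3)[OF that] unfolding pick_def by auto
  have "(\<lambda>u. enc (pick u)) ` S n \<subseteq> enc ` F" using pick by auto
  from one_variable[OF n finite_imageI[OF F(1)] this] obtain v where v: "v \<in> variable_words n"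
    and eq: "\<And>\<alpha>. \<alpha> \<in> letters n \<Longrightarrow> enc (pick (\<alpha> \<circ> v)) = enc (pick (trunc n v))" by blast
  obtain j where j: "v \<in> N n" "v \<in> T j" "v j = n + l" using v by (auto simp: variable_words_def)
  define x where "x = pick (trunc n v)"
  have tv: "trunc n v \<in> S n" using trunc_S[OF j(1)] .
  have x: "x \<in> S n" "trunc n v \<circ> x \<in> Z" using pick[OF tv] F(2) by (auto simp: x_def)
  have "v \<circ> x \<in> variable_words n"
  proof -
    have "n \<le> j" using M_le[OF NM[OF j(1)], of j] j(3) by simp
    then obtain i where i: "x \<in> T i" "x i = j" using S_reach[OF x(1)] by blast
    have "v \<circ> x \<in> T i" "(v \<circ> x) i = n + l" using comp_T[OF j(2) i] j i by auto
    then show ?thesis using comp_N[OF j(1) SN[OF x(1)]] unfolding variable_words_def by blast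
  qed
  moreover have "trunc n (v \<circ> x) \<in> Z"
    using trunc_trunc[OF NM[OF j(1)] SM[OF x(1)], of n] trunc_S_id[OF comp_S[OF tv x(1)]] x(2) by simp
  moreover have "trunc n (\<alpha> \<circ> (v \<circ> x)) \<in> Z" if a: "\<alpha> \<in> letters n" for \<alpha>
  proof -
    have S: "\<alpha> \<circ> v \<in> S n" using variable_words_letter[OF v a] .
    have "pick (\<alpha> \<circ> v) = x"
      using inj_onD[OF enc, of "pick (\<alpha> \<circ> v)" "pick (trunc n v)"] eq[OF a] pick(1)[OF S] pick(1)[OF tv] by (simp add: x_def)
    then have "(\<alpha> \<circ> v) \<circ> x \<in> Z" using pick(2)[OF S] by simp
    then show ?thesis using trunc_S_id[OF comp_S[OF S x(1)]] by (simp add: comp_assoc)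
  qed
  ultimately show thesis using that by blast
qed

text \<open>Since \<alpha> maps \<open>n + l\<close> to \<open>n\<close>, \<open>push\<close> turns
  \<open>m\<close> into a left factor fixing the numbers up to \<open>n\<close>, which the
  truncation does not see.\<close>

lemma letter_comp_trunc:
  assumes a: "\<alpha> \<in> letters n" and m: "m \<in> N (Suc (n + l))" and g: "g \<in> M"
  shows "trunc n (\<alpha> \<circ> (m \<circ> g)) = trunc n (\<alpha> \<circ> g)"
proof -
  have \<alpha>: "\<alpha> \<in> T (n + l)" "\<alpha> (n + l) = n" using a by (auto simp: letters_def)
  have "\<alpha> (Suc (n + l)) = Suc n" using T_add[OF \<alpha>(1), of 1] \<alpha>(2) by simp
  then obtain k where k: "k \<in> N (Suc n)" "\<alpha> \<circ> m = k \<circ> \<alpha>"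
    using push[OF T_mono[OF \<alpha>(1), of "Suc (n + l)"] m] by auto
  have "\<alpha> \<circ> (m \<circ> g) = k \<circ> (\<alpha> \<circ> g)" by (metis comp_assoc k(2))
  then show ?thesis using trunc_comp[OF k(1) comp_M[OF TM[OF \<alpha>(1)] g]] by simp
qed

text \<open>The numbers \<open>n, \<dots>, n + l - 1\<close> are the first block of variables of \<open>e\<close>; at the next level they count
  as letters, and a letter \<open>\<alpha>\<close> of the present level is a value for that block.\<close>

lemma large_step:
  assumes n: "1 \<le> n" and Z: "large n Z"
  shows "\<exists>e\<in>N n. trunc n e \<in> Z \<and>
    large (n + l) {z \<in> S (n + l). \<forall>\<alpha>\<in>letters n. trunc n (\<alpha> \<circ> (z \<circ> e)) \<in> Z}"
proof (rule ccontr)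
  assume neg: "\<not> ?thesis"
  \<comment> \<open>Failure of largeness speaks of finite words \<open>c\<close> only. Truncating
    \<open>z\<close>, and then \<open>c \<circ> k\<close>, extends it to every
    \<open>z \<in> N (n + l)\<close>.\<close>
  have star: "\<exists>k\<in>N (n + l). \<forall>z\<in>N (n + l). \<exists>\<alpha>\<in>letters n. trunc n (\<alpha> \<circ> (z \<circ> (k \<circ> e))) \<notin> Z"
    if e: "e \<in> N n" "trunc n e \<in> Z" for e
  proof -
    have "\<not> large (n + l) {z \<in> S (n + l). \<forall>\<alpha>\<in>letters n. trunc n (\<alpha> \<circ> (z \<circ> e)) \<in> Z}"
      using neg e by blast
    then obtain k where k: "k \<in> N (n + l)" and bad: "\<And>c. c \<in> S (n + l) \<Longrightarrow>
      trunc (n + l) (c \<circ> k) \<notin> {z \<in> S (n + l). \<forall>\<alpha>\<in>letters n. trunc n (\<alpha> \<circ> (z \<circ> e)) \<in> Z}"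
      unfolding large_def by blast
    have "\<exists>\<alpha>\<in>letters n. trunc n (\<alpha> \<circ> (z \<circ> (k \<circ> e))) \<notin> Z" if z: "z \<in> N (n + l)" for z
    proof -
      define c where "c = trunc (n + l) z"
      have cS: "c \<in> S (n + l)" unfolding c_def using trunc_S[OF z] .
      define d where "d = trunc (n + l) (c \<circ> k)"
      have ck: "c \<circ> k \<in> N (n + l)" using comp_N[OF SN[OF cS] k] .
      have dS: "d \<in> S (n + l)" unfolding d_def using trunc_S[OF ck] .
      then obtain \<alpha> where \<alpha>: "\<alpha> \<in> letters n" "trunc n (\<alpha> \<circ> (d \<circ> e)) \<notin> Z"
        using bad[OF cS] by (auto simp: d_def[symmetric] simp del: o_apply)
      obtain m where m: "m \<in> N (Suc (n + l))" "z = m \<circ> c"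
        unfolding c_def using trunc_factor[OF NM[OF z]] by blast
      obtain m' where m': "m' \<in> N (Suc (n + l))" "c \<circ> k = m' \<circ> d"
        unfolding d_def using trunc_factor[OF NM[OF ck]] by blast
      have de: "d \<circ> e \<in> M" using comp_M[OF SM[OF dS] NM[OF e(1)]] .
      have "z \<circ> (k \<circ> e) = (m \<circ> m') \<circ> (d \<circ> e)" by (metis comp_assoc m(2) m'(2))
      then have "trunc n (\<alpha> \<circ> (z \<circ> (k \<circ> e))) = trunc n (\<alpha> \<circ> (d \<circ> e))"
        using letter_comp_trunc[OF \<alpha>(1) comp_N[OF m(1) m'(1)] de] by metis
      then show ?thesis using \<alpha> by metis
    qed
    then show ?thesis using k by blast
  qed
  \<comment> \<open>The conclusion of \<open>star\<close> for \<open>v \<circ> A\<close>, with no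
    further shrinking. It is arranged for all finite \<open>v\<close> in advance, since the relevant
    \<open>v\<close> is found only after \<open>h\<close>.\<close>
  define Q where "Q j v A \<longleftrightarrow> (v \<in> N n \<longrightarrow> v j = n + l \<longrightarrow> trunc n (v \<circ> A) \<in> Z \<longrightarrow>
      (\<forall>z\<in>N (n + l). \<exists>\<alpha>\<in>letters n. trunc n (\<alpha> \<circ> (z \<circ> (v \<circ> A))) \<notin> Z))" for j v A
  have sub: "N (n + l) \<subseteq> N (Suc n)" using N_mono l_pos by simp
  obtain h where h: "h \<in> N n" and Q: "\<And>j v. n \<le> j \<Longrightarrow> v \<in> T j \<Longrightarrow> Q j v (h \<circ> id)"
  proof (rule fusion_T[of id "N n" n Q])
    fix j v A h assume v: "v \<in> T j" and A: "A \<in> N n" and QA: "Q j v A" and h: "h \<in> N j"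
    show "Q j v (h \<circ> A)" unfolding Q_def
    proof (intro impI ballI)
      fix z assume vN: "v \<in> N n" and vj: "v j = n + l" and tr: "trunc n (v \<circ> (h \<circ> A)) \<in> Z"
        and z: "z \<in> N (n + l)"
      obtain k where k: "k \<in> N (n + l)" "v \<circ> h = k \<circ> v" using push[OF v h] vj by auto
      have vh: "v \<circ> (h \<circ> A) = k \<circ> (v \<circ> A)" by (metis comp_assoc k(2))
      have "trunc n (v \<circ> A) \<in> Z"
        using tr trunc_comp[of k n "v \<circ> A"] k(1) sub comp_M[OF TM[OF v] NM[OF A]] unfolding vh by auto
      then have "\<exists>\<alpha>\<in>letters n. trunc n (\<alpha> \<circ> ((z \<circ> k) \<circ> (v \<circ> A))) \<notin> Z"
        using QA vN vj comp_N[OF z k(1)] unfolding Q_def by blast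
      then show "\<exists>\<alpha>\<in>letters n. trunc n (\<alpha> \<circ> (z \<circ> (v \<circ> (h \<circ> A)))) \<notin> Z"
        unfolding vh by (simp add: comp_assoc)
    qed
  next
    fix j v A assume v: "v \<in> T j" and A: "A \<in> N n"
    show "\<exists>h\<in>N j. Q j v (h \<circ> A)"
    proof (cases "v \<in> N n \<and> v j = n + l \<and> trunc n (v \<circ> A) \<in> Z")
      case True
      then obtain k where k: "k \<in> N (n + l)"
        "\<forall>z\<in>N (n + l). \<exists>\<alpha>\<in>letters n. trunc n (\<alpha> \<circ> (z \<circ> (k \<circ> (v \<circ> A)))) \<notin> Z"
        using star[of "v \<circ> A"] comp_N[OF _ A] by blast
      obtain h where h: "h \<in> N j" "v \<circ> h = k \<circ> v" using pull[OF v] k(1) True by metis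
      have "v \<circ> (h \<circ> A) = k \<circ> (v \<circ> A)" by (metis comp_assoc h(2))
      then show ?thesis using k(2) h(1) unfolding Q_def by metis
    next
      case False
      then have "Q j v (id \<circ> A)" by (auto simp: Q_def)
      then show ?thesis using id_N by blast
    qed
  qed (use id_N comp_N in blast)+
  \<comment> \<open>Largeness passes to the words whose instances in the subspace \<open>h\<close>
    lie in \<open>Z\<close>. The variable word obtained for this set violates \<open>Q\<close> with
    \<open>z = id\<close>.\<close>
  define Z' where "Z' = {c. trunc n (c \<circ> h) \<in> Z}"
  have "large n Z'"
    unfolding large_def
  proof
    fix k assume k: "k \<in> N n"
    obtain c where c: "c \<in> S n" "trunc n (c \<circ> (k \<circ> h)) \<in> Z"
      using Z comp_N[OF k h] unfolding large_def by blast
    then have "trunc n (c \<circ> k) \<in> Z'"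
      using trunc_trunc[OF comp_M[OF SM[OF c(1)] NM[OF k]] NM[OF h], of n]
      by (simp add: Z'_def comp_assoc)
    then show "\<exists>c\<in>S n. trunc n (c \<circ> k) \<in> Z'" using c(1) by blast
  qed
  from large_variable_word[OF n this] obtain v where v: "v \<in> variable_words n" "trunc n v \<in> Z'"
    "\<And>\<alpha>. \<alpha> \<in> letters n \<Longrightarrow> trunc n (\<alpha> \<circ> v) \<in> Z'" by blast
  obtain j where j: "v \<in> N n" "v \<in> T j" "v j = n + l" using v by (auto simp: variable_words_def)
  have hM: "h \<in> M" using NM[OF h] .
  have "n \<le> j" using M_le[OF NM[OF j(1)], of j] j(3) by simp
  from Q[OF this j(2)] have "trunc n (v \<circ> h) \<in> Z \<Longrightarrow> \<exists>\<alpha>\<in>letters n. trunc n (\<alpha> \<circ> (v \<circ> h)) \<notin> Z"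
    unfolding Q_def using j id_N[of "n + l"] by (metis comp_id id_comp)
  moreover have "trunc n (v \<circ> h) \<in> Z"
    using v(2) trunc_trunc[OF NM[OF j(1)] hM] by (simp add: Z'_def)
  ultimately obtain \<alpha> where \<alpha>: "\<alpha> \<in> letters n" "trunc n (\<alpha> \<circ> (v \<circ> h)) \<notin> Z" by blast
  have "trunc n (trunc n (\<alpha> \<circ> v) \<circ> h) \<in> Z" using v(3)[OF \<alpha>(1)] by (simp add: Z'_def)
  then show False
    using \<alpha>(2) trunc_trunc[OF SM[OF variable_words_letter[OF v(1) \<alpha>(1)]] hM, of n] by (simp add: comp_assoc)
qed

text \<open>By \<open>T_mod\<close> the length \<open>j - n\<close> is a positive multiple of
  \<open>l\<close>, so a whole first block exists and becomes \<alpha>. In \<open>d\<close> this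
  block turns into the fixed numbers from \<open>n\<close> to \<open>n + l - 1\<close>, the later
  letters stay, and the tail is raised by \<open>l\<close>.\<close>

lemma split_first_letter:
  assumes c: "c \<in> N n" "c \<in> T j" "c j = n" and j: "n < j"
  obtains \<alpha> d where "\<alpha> \<in> letters n" "d \<in> S (n + l)" "d \<in> T j" "d j = n + l" "n + l \<le> j" "c = \<alpha> \<circ> d"
proof -
  have "(n + (j - n)) mod l = (n + 0) mod l" using T_mod[OF c(2)] c(3) j by simp
  then have "(j - n) mod l = 0 mod l" unfolding mod_shift .
  then have "l dvd (j - n)" by auto
  then have nl: "n + l \<le> j" using j by (auto dest!: dvd_imp_le)
  have mod: "j mod l = (n + l) mod l" using T_mod[OF c(2)] c(3) by simp
  define \<alpha> where "\<alpha> x = (if x < n + l then c x else x - l)" for x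
  define d where "d x = (if x < n + l then x else if c x < n then c x else c x + l)" for x
  have less: "c x < n" if "x < j" for x using T_less[OF c(2) that] c(3) by simp
  have ge: "c x = n + (x - j)" if "j \<le> x" for x using T_ge[OF c(2) that] c(3) by simp
  have "\<alpha> \<in> letters n"
    by (rule letterI) (use N_fix[OF c(1)] less nl in \<open>auto simp: \<alpha>_def\<close>)
  moreover have "d x < n + l" if "n + l \<le> x" "x < j" for x using less[OF that(2)] that by (simp add: d_def)
  moreover have "d x = n + l + (x - j)" if "j \<le> x" for x
  proof -
    have "d x = c x + l" using ge[OF that] that nl by (simp add: d_def)
    then show ?thesis using ge[OF that] by linarith
  qed
  moreover have "d x = x" if "x < n + l" for x using that by (simp add: d_def)
  moreover have "c = \<alpha> \<circ> d"
  proof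
    fix x show "c x = (\<alpha> \<circ> d) x"
      using N_fix[OF c(1), of "c x"] by (auto simp: \<alpha>_def d_def)
  qed
  ultimately show thesis using that[of \<alpha> d] wordI[of "n + l" d j] nl mod by blast
qed

text \<open>If \<open>X\<close> is not large, some subspace misses it. Otherwise
  \<open>large_step\<close> is iterated, one block of variables at a time; each new set collects the
  words all of whose one-letter instances lie in the preceding set.\<close>

theorem pigeonhole:
  assumes n: "1 \<le> n"
  shows "\<exists>k\<in>N n. (\<forall>c\<in>S n. trunc n (c \<circ> k) \<in> X) \<or> (\<forall>c\<in>S n. trunc n (c \<circ> k) \<notin> X)"
proof (cases "large n X")
  case False
  then show ?thesis unfolding large_def by blast
next
  case True
  define \<nu> where "\<nu> i = n + i * l" for i
  have \<nu>: "1 \<le> \<nu> i" "i \<le> \<nu> i" "\<nu> (Suc i) = \<nu> i + l" "\<nu> 0 = n" for i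
    using n l_pos by (auto simp: \<nu>_def intro: trans_le_add2)
  define nxt where "nxt i Z e = {z \<in> S (\<nu> i + l). \<forall>\<alpha>\<in>letters (\<nu> i). trunc (\<nu> i) (\<alpha> \<circ> (z \<circ> e)) \<in> Z}" for i Z e
  have "\<exists>f. \<forall>i. (large (\<nu> i) (f i) \<and> (i = 0 \<longrightarrow> f i = X)) \<and>
      (\<exists>e\<in>N (\<nu> i). trunc (\<nu> i) e \<in> f i \<and> f (Suc i) = nxt i (f i) e)"
  proof (rule dependent_nat_choice)
    show "\<exists>x. large (\<nu> 0) x \<and> (0 = 0 \<longrightarrow> x = X)" using True \<nu>(4) by auto
    fix Z i assume "large (\<nu> i) Z \<and> (i = 0 \<longrightarrow> Z = X)"
    then have "large (\<nu> i) Z" by blast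
    from large_step[OF \<nu>(1) this]
    show "\<exists>Z'. (large (\<nu> (Suc i)) Z' \<and> (Suc i = 0 \<longrightarrow> Z' = X)) \<and>
        (\<exists>e\<in>N (\<nu> i). trunc (\<nu> i) e \<in> Z \<and> Z' = nxt i Z e)"
      unfolding \<nu>(3) nxt_def by blast
  qed
  then obtain f e where f: "f 0 = X" and e: "\<And>i. e i \<in> N (\<nu> i)" "\<And>i. trunc (\<nu> i) (e i) \<in> f i"
    "\<And>i. f (Suc i) = nxt i (f i) (e i)" by metis
  obtain K where K: "\<And>i. K i \<in> N (\<nu> i)" "\<And>i. K i = K (Suc i) \<circ> e i"
  proof (rule limit[of e \<nu>])
    show "mono \<nu>" using l_pos by (auto simp: mono_def \<nu>_def)
  qed (rule e \<nu>(2) that; assumption)+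
  have KSuc: "K (Suc i) \<in> N (Suc (\<nu> i))" for i
    using K(1)[of "Suc i"] N_mono[of "Suc (\<nu> i)" "\<nu> (Suc i)"] \<nu>(3)[of i] l_pos by auto
  \<comment> \<open>Induction on the length of \<open>c\<close>, for all levels at once: removing
    the first letter gives a shorter word one level higher, and membership in
    \<open>f (Suc i)\<close> was defined to yield membership in \<open>f i\<close> once the letter
    is put back. The empty word is \<open>c = id\<close>.\<close>
  have claim: "trunc (\<nu> i) (c \<circ> K i) \<in> f i" if "c \<in> N (\<nu> i)" "c \<in> T j" "c j = \<nu> i" for i c j
    using that
  proof (induction "j - \<nu> i" arbitrary: i c j rule: less_induct)
    case less
    note c = less.prems
    have le: "\<nu> i \<le> j" using M_le[OF TM[OF c(2)], of j] c(3) by simp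
    show ?case
    proof (cases "j = \<nu> i")
      case True
      have "c = id"
      proof
        fix x show "c x = id x"
          using N_fix[OF c(1), of x] T_ge[OF c(2), of x] c(3) True by (cases "x < \<nu> i") auto
      qed
      moreover have "trunc (\<nu> i) (K i) = trunc (\<nu> i) (e i)"
        using trunc_comp[OF KSuc NM[OF e(1)], of i] K(2)[of i] by metis
      ultimately show ?thesis using e(2) by simp
    next
      case False
      then have "\<nu> i < j" using le by simp
      from split_first_letter[OF c this] obtain \<alpha> d where
        \<alpha>: "\<alpha> \<in> letters (\<nu> i)" and d: "d \<in> S (\<nu> (Suc i))" "d \<in> T j" "d j = \<nu> (Suc i)"
        "\<nu> (Suc i) \<le> j" and cd: "c = \<alpha> \<circ> d" unfolding \<nu>(3) by blast
      define z where "z = trunc (\<nu> (Suc i)) (d \<circ> K (Suc i))"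
      have "j - \<nu> (Suc i) < j - \<nu> i" using d(4) \<nu>(3)[of i] l_pos by simp
      then have z: "z \<in> f (Suc i)" unfolding z_def by (rule less.hyps[OF _ SN[OF d(1)] d(2,3)])
      have dK: "d \<circ> K (Suc i) \<in> M" using comp_M[OF SM[OF d(1)] NM[OF K(1)]] .
      obtain m where m: "m \<in> N (Suc (\<nu> i + l))" "d \<circ> K (Suc i) = m \<circ> z"
        using trunc_factor[OF dK, of "\<nu> (Suc i)"] unfolding z_def \<nu>(3) by blast
      have zS: "z \<in> S (\<nu> i + l)" and zZ: "trunc (\<nu> i) (\<alpha> \<circ> (z \<circ> e i)) \<in> f i"
        using z \<alpha> unfolding e(3) nxt_def by auto
      have "c \<circ> K i = \<alpha> \<circ> (d \<circ> K (Suc i)) \<circ> e i" unfolding cd by (subst K(2)) (simp add: comp_assoc)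
      also have "\<dots> = \<alpha> \<circ> (m \<circ> (z \<circ> e i))" unfolding m(2) by (simp add: comp_assoc)
      finally show ?thesis
        using letter_comp_trunc[OF \<alpha> m(1) comp_M[OF SM[OF zS] NM[OF e(1)]], of i] zZ by simp
    qed
  qed
  have "trunc n (c \<circ> K 0) \<in> X" if "c \<in> S n" for c
    using S_T[OF that] SN[OF that] claim[of c 0] f \<nu>(4) by metis
  then show ?thesis using K(1)[of 0] \<nu>(4) by auto
qed

subsection \<open>The Ellentuck dichotomy\<close>

definition accepts :: "(nat \<Rightarrow> nat) set \<Rightarrow> nat \<Rightarrow> (nat \<Rightarrow> nat) \<Rightarrow> bool" where
  "accepts X n f \<longleftrightarrow> (\<forall>g\<in>N n. g \<circ> f \<in> X)"

definition rejects :: "(nat \<Rightarrow> nat) set \<Rightarrow> nat \<Rightarrow> (nat \<Rightarrow> nat) \<Rightarrow> bool" where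
  "rejects X n f \<longleftrightarrow> (\<forall>k\<in>N n. \<not> accepts X n (k \<circ> f))"

definition null :: "(nat \<Rightarrow> nat set) \<Rightarrow> (nat \<Rightarrow> nat) set \<Rightarrow> bool" where
  "null P Y \<longleftrightarrow> (\<forall>f\<in>rigid P. \<forall>n\<ge>1. \<exists>g\<in>N n. \<forall>h\<in>N n. h \<circ> (g \<circ> f) \<notin> Y)"

lemma accepts_comp: "accepts X n f \<Longrightarrow> k \<in> N n \<Longrightarrow> accepts X n (k \<circ> f)"
  unfolding accepts_def using comp_N by (metis comp_assoc)

lemma rejects_comp: "rejects X n f \<Longrightarrow> k \<in> N n \<Longrightarrow> rejects X n (k \<circ> f)"
  unfolding rejects_def using comp_N by (metis comp_assoc)

lemma accepts_mono: "accepts X m f \<Longrightarrow> m \<le> n \<Longrightarrow> accepts X n f"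
  unfolding accepts_def using N_mono by blast

lemma rejects_not_accepts: "rejects X n f \<Longrightarrow> \<not> accepts X n f"
  unfolding rejects_def using id_N[of n] by (metis id_comp)

lemma accepts_or_rejects: "\<exists>k\<in>N n. accepts X n (k \<circ> f) \<or> rejects X n (k \<circ> f)"
proof (cases "rejects X n f")
  case True
  then show ?thesis using id_N[of n] by (metis id_comp)
qed (auto simp: rejects_def)

text \<open>\<open>pull\<close> turns an improvement of \<open>b \<circ> A\<close> into one of
  \<open>A\<close>, and \<open>push\<close> protects it at later stages. The level
  \<open>b j\<close> is positive because \<open>b 0 < b j\<close>.\<close>

lemma dense_fusion:
  assumes f: "f \<in> rigid P" and n: "1 \<le> n"
    and persist: "\<And>j m f k. \<phi> j m f \<Longrightarrow> f \<in> rigid P \<Longrightarrow> k \<in> N m \<Longrightarrow> \<phi> j m (k \<circ> f)"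
    and ex: "\<And>j m f. 1 \<le> m \<Longrightarrow> f \<in> rigid P \<Longrightarrow> \<exists>k\<in>N m. \<phi> j m (k \<circ> f)"
  obtains h where "h \<in> N n" "\<And>j b. n \<le> j \<Longrightarrow> b \<in> T j \<Longrightarrow> \<phi> j (b j) (b \<circ> (h \<circ> f))"
proof (rule fusion_T[of f "rigid P" n "\<lambda>j b A. \<phi> j (b j) (b \<circ> A)"])
  fix j b A h assume b: "b \<in> T j" and A: "A \<in> rigid P" and \<phi>: "\<phi> j (b j) (b \<circ> A)" and h: "h \<in> N j"
  obtain k where k: "k \<in> N (b j)" "b \<circ> h = k \<circ> b" using push[OF b h] by blast
  have "\<phi> j (b j) (k \<circ> (b \<circ> A))" using persist[OF \<phi> comp_rigid[OF TM[OF b] A] k(1)] .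
  then show "\<phi> j (b j) (b \<circ> (h \<circ> A))" by (metis comp_assoc k(2))
next
  fix j b A assume b: "b \<in> T j" and j: "n \<le> j" and A: "A \<in> rigid P"
  have "b 0 < b j" using T_less[OF b, of 0] j n by simp
  then obtain k where k: "k \<in> N (b j)" "\<phi> j (b j) (k \<circ> (b \<circ> A))"
    using ex[of "b j" "b \<circ> A" j] comp_rigid[OF TM[OF b] A] by auto
  obtain h where "h \<in> N j" "b \<circ> h = k \<circ> b" using pull[OF b k(1)] by blast
  then show "\<exists>h\<in>N j. \<phi> j (b j) (b \<circ> (h \<circ> A))" using k(2) by (metis comp_assoc)
next
  show "\<And>A h. A \<in> rigid P \<Longrightarrow> h \<in> N n \<Longrightarrow> h \<circ> A \<in> rigid P" using comp_rigid NM by blast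
qed (use f that in blast)+

lemma S_trunc_factor:
  assumes "c \<in> N n" "k \<in> N n"
  obtains m where "m \<in> N (Suc n)" "c \<circ> k = m \<circ> trunc n (c \<circ> k)" "trunc n (c \<circ> k) \<in> S n"
  using trunc_factor[OF NM[OF comp_N[OF assms]], of n] trunc_S[OF comp_N[OF assms]] by blast

text \<open>After fusion every word in \<open>S n\<close> is accepted or rejected at level
  \<open>Suc n\<close>, a two-colouring to which \<open>pigeonhole\<close> applies. If all words of
  the subspace are accepted, so is the shrunk \<open>f\<close>, since every
  \<open>g \<in> N n\<close> factors through its truncation.\<close>

lemma accepts_or_rejects_extensions:
  assumes f: "f \<in> rigid P" and n: "1 \<le> n"
  shows "\<exists>k\<in>N n. accepts X n (k \<circ> f) \<or> (\<forall>c\<in>S n. rejects X (Suc n) (c \<circ> (k \<circ> f)))"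
proof -
  obtain h where h: "h \<in> N n" and dec: "\<And>j b. n \<le> j \<Longrightarrow> b \<in> T j \<Longrightarrow>
      accepts X (b j) (b \<circ> (h \<circ> f)) \<or> rejects X (b j) (b \<circ> (h \<circ> f))"
    using dense_fusion[where \<phi> = "\<lambda>j m f. accepts X m f \<or> rejects X m f", OF f n]
      accepts_comp rejects_comp accepts_or_rejects by metis
  define F where "F = h \<circ> f"
  have decF: "accepts X (Suc n) (c \<circ> F) \<or> rejects X (Suc n) (c \<circ> F)" if c: "c \<in> S n" for c
  proof -
    obtain j where j: "c \<in> T j" "c j = n" "n \<le> j" using S_T[OF c] by blast
    then have "c (Suc j) = Suc n" using T_add[OF j(1), of 1] by simp
    then show ?thesis using dec[of "Suc j" c] T_mono[OF j(1), of "Suc j"] j by (simp add: F_def)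
  qed
  obtain k where k: "k \<in> N n" and mono: "(\<forall>c\<in>S n. trunc n (c \<circ> k) \<in> {c. accepts X (Suc n) (c \<circ> F)})
      \<or> (\<forall>c\<in>S n. trunc n (c \<circ> k) \<notin> {c. accepts X (Suc n) (c \<circ> F)})"
    using pigeonhole[OF n] by blast
  have "accepts X n (k \<circ> F) \<or> (\<forall>c\<in>S n. rejects X (Suc n) (c \<circ> (k \<circ> F)))"
    using mono
  proof
    assume acc: "\<forall>c\<in>S n. trunc n (c \<circ> k) \<in> {c. accepts X (Suc n) (c \<circ> F)}"
    have "g \<circ> (k \<circ> F) \<in> X" if g: "g \<in> N n" for g
    proof -
      obtain k' where k': "k' \<in> N (Suc n)" "g = k' \<circ> trunc n g" using trunc_factor[OF NM[OF g]] by blast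
      define c where "c = trunc n g"
      have c: "c \<in> S n" unfolding c_def using trunc_S[OF g] .
      obtain m where m: "m \<in> N (Suc n)" "c \<circ> k = m \<circ> trunc n (c \<circ> k)"
        using S_trunc_factor[OF SN[OF c] k] by blast
      have "accepts X (Suc n) (trunc n (c \<circ> k) \<circ> F)" using acc c by blast
      then have "(k' \<circ> m) \<circ> (trunc n (c \<circ> k) \<circ> F) \<in> X"
        using comp_N[OF k'(1) m(1)] unfolding accepts_def by blast
      also have "(k' \<circ> m) \<circ> (trunc n (c \<circ> k) \<circ> F) = g \<circ> (k \<circ> F)"
        using m(2) k'(2) unfolding c_def by (metis comp_assoc)
      finally show ?thesis .
    qed
    then show ?thesis unfolding accepts_def by blast
  next
    assume rej: "\<forall>c\<in>S n. trunc n (c \<circ> k) \<notin> {c. accepts X (Suc n) (c \<circ> F)}"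
    have "rejects X (Suc n) (c \<circ> (k \<circ> F))" if c: "c \<in> S n" for c
    proof -
      obtain m where m: "m \<in> N (Suc n)" "c \<circ> k = m \<circ> trunc n (c \<circ> k)" "trunc n (c \<circ> k) \<in> S n"
        using S_trunc_factor[OF SN[OF c] k] by blast
      have "rejects X (Suc n) (trunc n (c \<circ> k) \<circ> F)" using rej c decF[OF m(3)] by blast
      from rejects_comp[OF this m(1)] show ?thesis using m(2) by (metis comp_assoc)
    qed
    then show ?thesis by blast
  qed
  then show ?thesis using comp_N[OF k h] unfolding F_def by (metis comp_assoc)
qed

text \<open>If no shrinking of \<open>f\<close> is accepted, a fusion makes rejection pass from each
  level to the next. A point of \<open>X\<close> would, by openness, be accepted at some
  level.\<close>

theorem open_dichotomy:
  assumes X: "\<And>f. f \<in> X \<Longrightarrow> \<exists>m. \<forall>g\<in>N m. g \<circ> f \<in> X"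
    and f: "f \<in> rigid P" and n: "1 \<le> n"
  shows "\<exists>h\<in>N n. (\<forall>g\<in>N n. g \<circ> (h \<circ> f) \<in> X) \<or> (\<forall>g\<in>N n. g \<circ> (h \<circ> f) \<notin> X)"
proof (cases "rejects X n f")
  case False
  then show ?thesis unfolding rejects_def accepts_def by blast
next
  case True
  obtain h where h: "h \<in> N n" and Q: "\<And>j b. n \<le> j \<Longrightarrow> b \<in> T j \<Longrightarrow>
      accepts X (b j) (b \<circ> (h \<circ> f)) \<or> (\<forall>c\<in>S (b j). rejects X (Suc (b j)) (c \<circ> (b \<circ> (h \<circ> f))))"
  proof (rule dense_fusion[where \<phi> = "\<lambda>j m f. accepts X m f \<or> (\<forall>c\<in>S m. rejects X (Suc m) (c \<circ> f))",
        OF f n])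
    fix m f k assume \<phi>: "accepts X m f \<or> (\<forall>c\<in>S m. rejects X (Suc m) (c \<circ> f))" and k: "k \<in> N m"
    show "accepts X m (k \<circ> f) \<or> (\<forall>c\<in>S m. rejects X (Suc m) (c \<circ> (k \<circ> f)))"
      using \<phi>
    proof
      assume rej: "\<forall>c\<in>S m. rejects X (Suc m) (c \<circ> f)"
      have "rejects X (Suc m) (c \<circ> (k \<circ> f))" if c: "c \<in> S m" for c
      proof -
        obtain q where q: "q \<in> N (Suc m)" "c \<circ> k = q \<circ> trunc m (c \<circ> k)" "trunc m (c \<circ> k) \<in> S m"
          using S_trunc_factor[OF SN[OF c] k] by blast
        have "rejects X (Suc m) (trunc m (c \<circ> k) \<circ> f)" using rej q(3) by blast
        from rejects_comp[OF this q(1)] show ?thesis using q(2) by (metis comp_assoc)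
      qed
      then show ?thesis by blast
    qed (use accepts_comp k in blast)
  qed (use accepts_or_rejects_extensions in blast)+
  \<comment> \<open>The truncation of \<open>g\<close> at \<open>m\<close> is rejected at level
    \<open>m\<close> by induction, hence not accepted, so the fused condition with
    \<open>c = id\<close> rejects it at \<open>Suc m\<close>; \<open>g\<close> only adds a factor
    from \<open>N (Suc m)\<close>.\<close>
  have rej: "\<forall>g\<in>N n. rejects X m (g \<circ> (h \<circ> f))" if "n \<le> m" for m
    using that
  proof (induction m rule: dec_induct)
    case base
    show ?case using rejects_comp[OF rejects_comp[OF True h]] by blast
  next
    case (step m)
    show ?case
    proof
      fix g assume g: "g \<in> N n"
      obtain j k where b: "trunc m g \<in> T j" "trunc m g j = m" "m \<le> j"
        and k: "k \<in> N (Suc m)" "g = k \<circ> trunc m g" using trunc_props[OF NM[OF g], of m] by metis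
      define b where "b = trunc m g"
      have bT: "b \<in> T j" "b j = m" unfolding b_def using b by blast+
      have "b \<in> N n" unfolding b_def using trunc_N[OF g step.hyps(1)] .
      then have "\<not> accepts X m (b \<circ> (h \<circ> f))" using step.IH rejects_not_accepts by blast
      then have all: "\<forall>c\<in>S m. rejects X (Suc m) (c \<circ> (b \<circ> (h \<circ> f)))"
        using Q[OF _ bT(1)] bT(2) b(3) step.hyps(1) by auto
      have "rejects X (Suc m) (id \<circ> (b \<circ> (h \<circ> f)))" using all id_S by blast
      from rejects_comp[OF this k(1)] show "rejects X (Suc m) (g \<circ> (h \<circ> f))"
        using k(2) unfolding b_def by (metis comp_assoc id_comp)
    qed
  qed
  have "g \<circ> (h \<circ> f) \<notin> X" if g: "g \<in> N n" for g
  proof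
    assume "g \<circ> (h \<circ> f) \<in> X"
    then obtain m where "accepts X m (g \<circ> (h \<circ> f))" using X unfolding accepts_def by blast
    then have "accepts X (max m n) (g \<circ> (h \<circ> f))" by (rule accepts_mono) simp
    then show False using rej[of "max m n"] g rejects_not_accepts by auto
  qed
  then show ?thesis using h by blast
qed

text \<open>Stage \<open>j\<close> of the fusion avoids only the sets up to \<open>Y j\<close>, so
  every requirement stays finite.\<close>

theorem null_UN:
  assumes Y: "\<And>i :: nat. null P (Y i)"
  shows "null P (\<Union>i. Y i)"
  unfolding null_def
proof (intro ballI allI impI)
  fix f and n :: nat assume f: "f \<in> rigid P" and n: "1 \<le> n"
  obtain h where h: "h \<in> N n" and Q: "\<And>j b. n \<le> j \<Longrightarrow> b \<in> T j \<Longrightarrow>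
      \<forall>i\<in>{..j}. \<forall>g\<in>N (b j). g \<circ> (b \<circ> (h \<circ> f)) \<notin> Y i"
  proof (rule dense_fusion[where \<phi> = "\<lambda>j m f. \<forall>i\<in>{..j}. \<forall>g\<in>N m. g \<circ> f \<notin> Y i", OF f n])
    fix j m f k assume "\<forall>i\<in>{..j}. \<forall>g\<in>N m. g \<circ> f \<notin> Y i" "k \<in> N m"
    then show "\<forall>i\<in>{..j}. \<forall>g\<in>N m. g \<circ> (k \<circ> f) \<notin> Y i" using comp_N by (metis comp_assoc)
  next
    fix j m :: nat and f assume m: "1 \<le> m" and f: "f \<in> rigid P"
    show "\<exists>k\<in>N m. \<forall>i\<in>{..j}. \<forall>g\<in>N m. g \<circ> (k \<circ> f) \<notin> Y i"
    proof (rule finite_fusion[where Q = "\<lambda>i A. \<forall>g\<in>N m. g \<circ> A \<notin> Y i" and \<C> = "rigid P"])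
      show "\<And>b A h. \<forall>g\<in>N m. g \<circ> A \<notin> Y b \<Longrightarrow> h \<in> N m \<Longrightarrow> \<forall>g\<in>N m. g \<circ> (h \<circ> A) \<notin> Y b"
        using comp_N by (metis comp_assoc)
      show "\<And>b A. A \<in> rigid P \<Longrightarrow> \<exists>h\<in>N m. \<forall>g\<in>N m. g \<circ> (h \<circ> A) \<notin> Y b"
        using Y m unfolding null_def by blast
    qed (use f comp_rigid NM in auto)
  qed (rule that)
  have "g \<circ> (h \<circ> f) \<notin> Y i" if g: "g \<in> N n" for g i
  proof -
    \<comment> \<open>Cutting at \<open>max n i\<close> ensures \<open>i \<le> j\<close>, so that
      \<open>Y i\<close> is among the sets avoided at stage \<open>j\<close>.\<close>
    obtain j k where b: "trunc (max n i) g \<in> T j" "trunc (max n i) g j = max n i" "max n i \<le> j"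
      and k: "k \<in> N (Suc (max n i))" "g = k \<circ> trunc (max n i) g"
      using trunc_props[OF NM[OF g], of "max n i"] by metis
    have "k \<in> N (max n i)" using k(1) N_mono[OF le_SucI[OF order_refl]] by blast
    then have "k \<circ> (trunc (max n i) g \<circ> (h \<circ> f)) \<notin> Y i" using Q[OF _ b(1)] b(2,3) by auto
    then show ?thesis using k(2) by (metis comp_assoc)
  qed
  then show "\<exists>g\<in>N n. \<forall>ha\<in>N n. ha \<circ> (g \<circ> f) \<notin> (\<Union>i. Y i)" using h by blast
qed

end

section \<open>Equivalence relations as kernels\<close>

definition ker :: "(nat \<Rightarrow> nat) \<Rightarrow> nat rel" where
  "ker f = {(x, y). f x = f y}"

lemma equiv_ker: "equiv UNIV (ker f)"
  by (auto simp: ker_def equiv_def refl_on_def sym_def trans_def)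

lemma quotient_eq_range: "UNIV // E = range (\<lambda>x. E `` {x})"
  by (auto simp: quotient_def)

lemma coarsening_iff_subset:
  assumes E: "equiv UNIV E" and F: "equiv UNIV F"
  shows "coarsening E F \<longleftrightarrow> F \<subseteq> E"
proof
  assume c: "coarsening E F"
  show "F \<subseteq> E"
  proof (rule subrelI)
    fix x y assume xy: "(x, y) \<in> F"
    obtain \<C> where \<C>: "\<C> \<subseteq> UNIV // F" "E `` {x} = \<Union>\<C>"
      using c unfolding coarsening_def by (metis UNIV_I quotientI)
    have "x \<in> E `` {x}" using E by (meson UNIV_I equiv_class_self)
    then obtain D where D: "D \<in> \<C>" "x \<in> D" using \<C> by blast
    then have "y \<in> D" using \<C>(1) xy F by (meson in_quotient_imp_closed subsetD)
    then show "(x, y) \<in> E" using D \<C> by blast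
  qed
next
  assume FE: "F \<subseteq> E"
  show "coarsening E F" unfolding coarsening_def
  proof
    fix C assume C: "C \<in> UNIV // E"
    have "C = \<Union>((\<lambda>y. F `` {y}) ` C)"
    proof
      show "C \<subseteq> \<Union>((\<lambda>y. F `` {y}) ` C)" 
        using equiv_class_self[OF F UNIV_I] by blast
      show "\<Union>((\<lambda>y. F `` {y}) ` C) \<subseteq> C" using in_quotient_imp_closed[OF E C] FE by blast
    qed
    moreover have "(\<lambda>y. F `` {y}) ` C \<subseteq> UNIV // F" by (auto intro: quotientI)
    ultimately show "\<exists>\<C>\<subseteq>UNIV // F. C = \<Union>\<C>" by blast
  qed
qed

lemma enumerate_range_strict_mono:
  fixes s :: "nat \<Rightarrow> nat"
  assumes s: "strict_mono s"
  shows "enumerate (range s) n = s n"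
proof (induction n rule: less_induct)
  case (less n)
  let ?e = "enumerate (range s)"
  have inf: "infinite (range s)" using s by (simp add: range_inj_infinite strict_mono_imp_inj_on)
  obtain m where m: "?e n = s m" using enumerate_in_set[OF inf, of n] by blast
  obtain m' where m': "s n = ?e m'" using range_enumerate[OF inf] by blast
  have "\<not> m < n"
  proof
    assume "m < n"
    then have "?e m < ?e n" using enumerate_mono[OF _ inf] by blast
    then show False using less[OF \<open>m < n\<close>] m by simp
  qed
  moreover have "\<not> m' < n"
    using less[of m'] m' s by (metis less_irrefl strict_mono_eq)
  then have "?e n \<le> s n" using m' enumerate_mono_le_iff[OF inf] by simp
  then have "m \<le> n" using m s by (simp add: strict_mono_less_eq)
  ultimately show ?case using m by simp
qed

locale coloured_space = coloured_surjections +
  fixes P :: "nat \<Rightarrow> nat set"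
  assumes disjoint: "disjoint_family_on P {..<l}"
begin

abbreviation "K \<equiv> rigid P"
abbreviation "R \<equiv> coloured_equivs l P"

lemma K_first:
  assumes "f \<in> K"
  obtains p where "p \<in> P (k mod l)" "f p = k" "\<And>x. x < p \<Longrightarrow> f x < k" "(LEAST x. f x = k) = p"
  by (rule first_occurrence[OF assms, of k]) (rule that)

lemma strict_mono_first:
  assumes f: "f \<in> K" shows "strict_mono (\<lambda>k. LEAST x. f x = k)"
  unfolding strict_mono_def
proof (intro allI impI)
  fix k k' :: nat assume k: "k < k'"
  obtain p where p: "f p = k" "\<And>x. x < p \<Longrightarrow> f x < k" "(LEAST x. f x = k) = p"
    by (rule K_first[OF f, of k]) (rule that)
  obtain p' where p': "f p' = k'" "(LEAST x. f x = k') = p'"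
    by (rule K_first[OF f, of k']) (rule that)
  have "p < p'"
  proof (rule ccontr)
    assume "\<not> p < p'"
    then have "f p' \<le> k" using p(2)[of p'] p(1) by (cases "p' = p") auto
    then show False using k p'(1) by simp
  qed
  then show "(LEAST x. f x = k) < (LEAST x. f x = k')" unfolding p p' .
qed

lemma quotient_ker: "UNIV // ker f = range (\<lambda>x. {y. f y = f x})"
  unfolding quotient_eq_range ker_def by (intro image_cong) auto

lemma class_minima_ker:
  assumes f: "f \<in> K" shows "class_minima (ker f) = range (\<lambda>k. LEAST x. f x = k)"
proof -
  have "class_minima (ker f) = (\<lambda>k. LEAST x. f x = k) ` range f"
    unfolding class_minima_def quotient_ker by (simp add: image_image)
  moreover have "k \<in> range f" for k by (rule K_first[OF f, of k]) blast
  then have "range f = UNIV" by blast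
  ultimately show ?thesis by simp
qed

lemma class_min_ker: "f \<in> K \<Longrightarrow> class_min (ker f) k = (LEAST x. f x = k)"
  unfolding class_min_def using class_minima_ker enumerate_range_strict_mono[OF strict_mono_first] by simp

lemma ker_in:
  assumes f: "f \<in> K" shows "ker f \<in> R"
proof -
  have "infinite (class_minima (ker f))"
    unfolding class_minima_ker[OF f] using strict_mono_first[OF f]
    by (simp add: range_inj_infinite strict_mono_imp_inj_on)
  then have "infinite (UNIV // ker f)" unfolding class_minima_def by blast
  moreover have "class_min (ker f) k \<in> P (k mod l)" for k
    unfolding class_min_ker[OF f] by (rule K_first[OF f, of k]) simp
  ultimately show ?thesis by (simp add: coloured_equivs_def equiv_ker)
qed

lemma ker_surj:
  assumes E: "E \<in> R" obtains f where "f \<in> K" "E = ker f"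
proof -
  have eq: "equiv UNIV E" and inf: "infinite (UNIV // E)" and col: "\<And>k. class_min E k \<in> P (k mod l)"
    using E by (auto simp: coloured_equivs_def)
  define mn where "mn x = (LEAST y. y \<in> E `` {x})" for x
  have self: "x \<in> E `` {x}" for x using eq by (meson UNIV_I equiv_class_self)
  have mn_in: "(x, mn x) \<in> E" for x
    using LeastI[of "\<lambda>y. y \<in> E `` {x}", OF self] by (simp add: mn_def)
  have mn_le: "mn x \<le> x" for x unfolding mn_def by (rule Least_le) (rule self)
  have mn_eq: "mn x = mn y" if "(x, y) \<in> E" for x y
    using equiv_class_eq[OF eq that] by (simp add: mn_def)
  have mn_iff: "mn x = mn y \<longleftrightarrow> (x, y) \<in> E" for x y
    using mn_eq mn_in eq by (metis equiv_def symE transE)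
  have cm: "class_minima E = range mn"
    unfolding class_minima_def quotient_eq_range mn_def by (simp add: image_image)
  have infm: "infinite (class_minima E)"
  proof
    assume "finite (class_minima E)"
    moreover have "UNIV // E \<subseteq> (\<lambda>m. E `` {m}) ` class_minima E"
    proof
      fix C assume "C \<in> UNIV // E"
      then obtain x where "C = E `` {x}" by (auto simp: quotient_def)
      then have "C = E `` {mn x}" using equiv_class_eq[OF eq mn_in] by simp
      then show "C \<in> (\<lambda>m. E `` {m}) ` class_minima E" unfolding cm by blast
    qed
    ultimately show False using inf finite_surj by blast
  qed
  \<comment> \<open>The number of the class of \<open>x\<close> when classes are listed by their
    minima.\<close>
  define f where "f x = (SOME k. class_min E k = mn x)" for x
  have f: "class_min E (f x) = mn x" for x
  proof -
    have "mn x \<in> range (enumerate (class_minima E))" using range_enumerate[OF infm] cm by blast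
    then have "\<exists>k. class_min E k = mn x" unfolding class_min_def by (metis rangeE)
    then show ?thesis unfolding f_def by (rule someI_ex)
  qed
  have sm: "class_min E i < class_min E k \<longleftrightarrow> i < k" for i k
    unfolding class_min_def using enumerate_mono_iff[OF infm] by simp
  then have inj: "class_min E i = class_min E k \<longleftrightarrow> i = k" for i k
    by (metis less_irrefl linorder_neqE_nat)
  have "f x = f y \<longleftrightarrow> (x, y) \<in> E" for x y using f inj mn_iff by metis
  then have "E = ker f" by (auto simp: ker_def)
  moreover have "f \<in> K" unfolding rigid_def
  proof (intro CollectI allI bexI conjI impI)
    fix k
    have "class_min E k \<in> class_minima E"
      unfolding class_min_def using enumerate_in_set[OF infm] .
    then obtain x where x: "class_min E k = mn x" unfolding cm by blast
    have "mn (mn x) = mn x" using mn_iff mn_in by metis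
    then show "f (class_min E k) = k" using f[of "mn x"] x inj by metis
    show "f y < k" if "y < class_min E k" for y
      using f[of y] mn_le[of y] that sm[of "f y" k] by simp
  qed (rule col)
  ultimately show thesis using that by blast
qed

lemma comp_K: "g \<in> M \<Longrightarrow> f \<in> K \<Longrightarrow> g \<circ> f \<in> K"
  by (rule comp_rigid)

lemma ker_mono: "ker f \<subseteq> ker (g \<circ> f)"
  by (auto simp: ker_def)

lemma colours_disjoint:
  assumes "x \<in> P (i mod l)" "x \<in> P (k mod l)" shows "i mod l = k mod l"
proof (rule ccontr)
  assume "i mod l \<noteq> k mod l"
  moreover have "i mod l < l" "k mod l < l" using l_pos by simp_all
  ultimately have "P (i mod l) \<inter> P (k mod l) = {}"
    using disjoint unfolding disjoint_family_on_def by blast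
  then show False using assms by blast
qed

text \<open>The first occurrence \<open>q\<close> of \<open>k\<close> in \<open>h\<close> is also
  that of \<open>f q\<close> in \<open>f\<close>, so its colour has index \<open>f q mod l\<close>
  as well as \<open>k mod l\<close>. Disjointness of the colours yields the congruence that
  \<open>M\<close> demands.\<close>

lemma ker_subset_factor:
  assumes f: "f \<in> K" and h: "h \<in> K" and sub: "ker f \<subseteq> ker h"
  obtains g where "g \<in> M" "h = g \<circ> f"
proof -
  have hf: "h x = h y" if "f x = f y" for x y using sub that by (auto simp: ker_def)
  define s where "s k = (LEAST x. f x = k)" for k
  have fs: "f (s k) = k" "s k \<in> P (k mod l)" "\<And>x. x < s k \<Longrightarrow> f x < k" for k
  proof -
    obtain p where p: "p \<in> P (k mod l)" "f p = k" "\<And>x. x < p \<Longrightarrow> f x < k" "(LEAST x. f x = k) = p"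
      by (rule K_first[OF f, of k]) (rule that)
    show "f (s k) = k" "s k \<in> P (k mod l)" "\<And>x. x < s k \<Longrightarrow> f x < k"
      unfolding s_def p(4) by (fact p)+
  qed
  define g where "g k = h (s k)" for k
  have "h x = g (f x)" for x unfolding g_def by (rule hf) (rule fs(1)[symmetric])
  then have "h = g \<circ> f" by auto
  moreover have "g \<in> M"
  proof (rule MI)
    fix k
    obtain q where q: "q \<in> P (k mod l)" "h q = k" "\<And>x. x < q \<Longrightarrow> h x < k"
      by (rule K_first[OF h, of k]) (rule that)
    have hs: "h (s (f q)) = k" using hf[OF fs(1)] q(2) by simp
    have "s (f q) = q"
    proof (rule linorder_cases[of "s (f q)" q])
      assume "s (f q) < q" then show ?thesis using q(3) hs by force
    next
      assume "q < s (f q)" then show ?thesis using fs(3)[of q "f q"] by simp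
    qed
    then have "q \<in> P (f q mod l)" using fs(2)[of "f q"] by simp
    then have "f q mod l = k mod l" using colours_disjoint q(1) by blast
    moreover have "g x < k" if "x < f q" for x
    proof -
      have "s x < s (f q)" using strict_mono_first[OF f] that unfolding s_def strict_mono_def by blast
      then show ?thesis unfolding g_def \<open>s (f q) = q\<close> by (rule q(3))
    qed
    ultimately show "\<exists>p. p mod l = k mod l \<and> g p = k \<and> (\<forall>x<p. g x < k)"
      using hs by (intro exI[of _ "f q"]) (auto simp: g_def)
  qed
  ultimately show thesis using that by blast
qed

section \<open>Restrictions and basic sets as orbits\<close>

lemma restr_ker_eq:
  assumes f: "f \<in> K" and g: "g \<in> N (Suc n)" shows "restr n (ker (g \<circ> f)) = restr n (ker f)"
proof -
  obtain p where p: "f p = n" "\<And>x. x < p \<Longrightarrow> f x < n" "(LEAST x. f x = n) = p"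
    by (rule K_first[OF f, of n]) (rule that)
  have g': "g (f x) = f x" if "x \<le> p" for x
    using N_fix[OF g] p that by (cases "x = p") (auto simp: less_Suc_eq)
  have "(LEAST x. (g \<circ> f) x = n) = p"
  proof (rule Least_equality)
    show "(g \<circ> f) p = n" using g'[of p] p by simp
    show "p \<le> y" if "(g \<circ> f) y = n" for y
      using that g'[of y] p(2)[of y] by (metis comp_apply leI less_irrefl less_imp_le)
  qed
  then have "class_min (ker (g \<circ> f)) n = p" using class_min_ker[OF comp_K[OF NM[OF g] f]] by simp
  moreover have "class_min (ker f) n = p" using class_min_ker[OF f] p by simp
  moreover have "g (f x) = g (f y) \<longleftrightarrow> f x = f y" if "x < p" "y < p" for x y
    using g'[of x] g'[of y] that by simp
  then have "ker (g \<circ> f) \<inter> {..<p} \<times> {..<p} = ker f \<inter> {..<p} \<times> {..<p}"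
    by (auto simp: ker_def)
  ultimately show ?thesis unfolding restr_def by simp
qed

text \<open>New values appear in increasing order without gaps; this lets the kernel determine the
  function on initial segments in \<open>agree_below\<close>.\<close>

lemma value_eq_card:
  assumes f: "f \<in> K" and new: "\<And>y. y < x \<Longrightarrow> f y \<noteq> f x" shows "f x = card (f ` {..<x})"
proof -
  obtain p where p: "f p = f x" "\<And>y. y < p \<Longrightarrow> f y < f x"
    by (rule K_first[OF f, of "f x"]) (rule that)
  have "x \<le> p" using new[of p] p(1) by (metis not_le)
  moreover have "p \<le> x" using p(2)[of x] p(1) by (metis less_irrefl not_le)
  ultimately have px: "p = x" by simp
  have "f ` {..<x} = {..<f x}"
  proof
    show "f ` {..<x} \<subseteq> {..<f x}" using p px by auto
    show "{..<f x} \<subseteq> f ` {..<x}"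
    proof
      fix k assume k: "k \<in> {..<f x}"
      obtain q where q: "f q = k" "\<And>y. y < q \<Longrightarrow> f y < k"
        by (rule K_first[OF f, of k]) (rule that)
      have "q < x"
      proof (rule ccontr)
        assume "\<not> q < x"
        then have "f x \<le> k" using q by (cases "x = q") (auto intro: less_imp_le)
        then show False using k by simp
      qed
      then show "k \<in> f ` {..<x}" using q by blast
    qed
  qed
  then show ?thesis by simp
qed

lemma agree_below:
  assumes f: "f \<in> K" and h: "h \<in> K"
    and ker: "\<And>x y. x < q \<Longrightarrow> y < q \<Longrightarrow> f x = f y \<longleftrightarrow> h x = h y"
  shows "x < q \<Longrightarrow> f x = h x"
proof (induction x rule: less_induct)
  case (less x)
  have below: "f y = h y" if "y < x" for y using less that by simp
  show ?case
  proof (cases "\<exists>y<x. f y = f x")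
    case True
    then obtain y where "y < x" "f y = f x" by blast
    then show ?thesis using below[of y] ker[of y x] less.prems by simp
  next
    case False
    then have "\<And>y. y < x \<Longrightarrow> h y \<noteq> h x" using ker less.prems by (metis less_trans)
    then have "h x = card (h ` {..<x})" by (rule value_eq_card[OF h])
    moreover have "f x = card (f ` {..<x})" using value_eq_card[OF f] False by blast
    moreover have "f ` {..<x} = h ` {..<x}" using below by auto
    ultimately show ?thesis by simp
  qed
qed

text \<open>The diagonal pairs show that both restrictions have the same length \<open>p\<close>.
  Below \<open>p\<close> the two functions agree, and at \<open>p\<close> each takes a new value,
  namely the number of earlier ones; hence \<open>g n = n\<close>.\<close>

lemma restr_eq_imp_fix:
  assumes f: "f \<in> K" and g: "g \<in> M" and eq: "restr m (ker (g \<circ> f)) = restr n (ker f)"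
  shows "g \<in> N (Suc n)"
proof -
  have gf: "g \<circ> f \<in> K" using comp_K[OF g f] .
  obtain p where p: "f p = n" "\<And>x. x < p \<Longrightarrow> f x < n" "(LEAST x. f x = n) = p"
    by (rule K_first[OF f, of n]) (rule that)
  obtain q where q: "(g \<circ> f) q = m" "\<And>x. x < q \<Longrightarrow> (g \<circ> f) x < m" "(LEAST x. (g \<circ> f) x = m) = q"
    by (rule K_first[OF gf, of m]) (rule that)
  have r: "restr m (ker (g \<circ> f)) = ker (g \<circ> f) \<inter> {..<q} \<times> {..<q}" "restr n (ker f) = ker f \<inter> {..<p} \<times> {..<p}"
    unfolding restr_def class_min_ker[OF f] class_min_ker[OF gf] p q by simp_all
  have "x < q \<longleftrightarrow> (x, x) \<in> restr m (ker (g \<circ> f))" "x < p \<longleftrightarrow> (x, x) \<in> restr n (ker f)" for x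
    unfolding r by (auto simp: ker_def)
  then have "\<And>x. x < q \<longleftrightarrow> x < p" using eq by simp
  then have qp: "q = p" by (metis linorder_neqE_nat less_irrefl)
  have agree: "(g \<circ> f) x = f x" if "x < p" for x
  proof (rule agree_below[OF gf f _ that])
    fix x y assume "x < p" "y < p"
    moreover have "(x, y) \<in> ker (g \<circ> f) \<inter> {..<p} \<times> {..<p} \<longleftrightarrow> (x, y) \<in> ker f \<inter> {..<p} \<times> {..<p}"
      using eq unfolding r qp by (rule arg_cong)
    ultimately show "(g \<circ> f) x = (g \<circ> f) y \<longleftrightarrow> f x = f y" by (simp add: ker_def)
  qed
  have "(g \<circ> f) p = card ((g \<circ> f) ` {..<p})"
    by (rule value_eq_card[OF gf]) (use q qp in force)
  moreover have "f p = card (f ` {..<p})"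
    by (rule value_eq_card[OF f]) (use p in force)
  moreover have "(g \<circ> f) ` {..<p} = f ` {..<p}" using agree by auto
  ultimately have gn: "g n = n" using p by simp
  have "g i = i" if i: "i < n" for i
  proof -
    obtain x where x: "f x = i" "(LEAST x. f x = i) = x"
      by (rule K_first[OF f, of i]) (rule that)
    have "x < p" using strict_mono_first[OF f] i x(2) p(3) unfolding strict_mono_def by blast
    then show ?thesis using agree[of x] x by simp
  qed
  then show ?thesis using g gn by (auto simp: N_def less_Suc_eq)
qed

text \<open>The index is \<open>Suc n\<close> because the domain of the restriction ends at the
  minimum of class \<open>n\<close>, which must then remain a minimum: \<open>g\<close> fixes
  \<open>n\<close> too.\<close>

lemma basic_set_ker:
  assumes f: "f \<in> K"
  shows "basic_set R (restr n (ker f)) (ker f) = (\<lambda>g. ker (g \<circ> f)) ` N (Suc n)"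
proof (intro equalityI subsetI)
  fix A assume A: "A \<in> basic_set R (restr n (ker f)) (ker f)"
  then obtain h where h: "h \<in> K" "A = ker h" unfolding basic_set_def using ker_surj by blast
  have "ker f \<subseteq> ker h"
    using A h coarsening_iff_subset[OF equiv_ker equiv_ker] by (simp add: basic_set_def)
  then obtain g where g: "g \<in> M" "h = g \<circ> f" using ker_subset_factor[OF f h(1)] by blast
  obtain m where "restr m A = restr n (ker f)" using A by (auto simp: basic_set_def)
  then have "g \<in> N (Suc n)" using restr_eq_imp_fix[OF f g(1)] g h by simp
  then show "A \<in> (\<lambda>g. ker (g \<circ> f)) ` N (Suc n)" using g h by blast
next
  fix A assume "A \<in> (\<lambda>g. ker (g \<circ> f)) ` N (Suc n)"
  then obtain g where g: "g \<in> N (Suc n)" "A = ker (g \<circ> f)" by blast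
  show "A \<in> basic_set R (restr n (ker f)) (ker f)"
    unfolding basic_set_def
    using ker_in[OF comp_K[OF NM[OF g(1)] f]] coarsening_iff_subset[OF equiv_ker equiv_ker] ker_mono
      restr_ker_eq[OF f g(1)] g(2) by blast
qed

text \<open>A basic set can be based again at any of its points without changing the approximation,
  which reduces all cases to \<open>basic_set_ker\<close>.\<close>

lemma basic_set_point:
  assumes B: "B \<in> R" and A: "A \<in> basic_set R a B"
  obtains f n where "f \<in> K" "A = ker f" "a = restr n (ker f)"
    "basic_set R a (ker f) \<subseteq> basic_set R a B"
proof -
  obtain n where n: "A \<in> R" "coarsening A B" "restr n A = a" using A by (auto simp: basic_set_def)
  obtain f where f: "f \<in> K" "A = ker f" using ker_surj[OF n(1)] by blast
  have eqv: "equiv UNIV E" if "E \<in> R" for E using that by (simp add: coloured_equivs_def)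
  have "basic_set R a A \<subseteq> basic_set R a B"
    using coarsening_iff_subset[OF eqv eqv] n(1,2) B unfolding basic_set_def by (auto dest: subset_trans)
  then show thesis using that f n(3) by blast
qed

text \<open>The family \<Q> is left arbitrary so that one translation serves both Ramsey and Ramsey
  null sets. The bound \<open>n \<ge> 1\<close> reflects the shift from \<open>restr m\<close> to
  \<open>N (Suc m)\<close>.\<close>

lemma basic_condition_iff:
  "(\<forall>a\<in>approximations R. \<forall>B\<in>R. basic_set R a B \<noteq> {} \<longrightarrow>
      (\<exists>A\<in>basic_set R a B. basic_set R a A \<in> \<Q>))
    \<longleftrightarrow> (\<forall>f\<in>K. \<forall>n\<ge>1. \<exists>g\<in>N n. (\<lambda>h. ker (h \<circ> (g \<circ> f))) ` N n \<in> \<Q>)" (is "?L \<longleftrightarrow> ?R")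
proof
  assume L: ?L
  show ?R
  proof (intro ballI allI impI)
    fix f and n :: nat assume f: "f \<in> K" and "1 \<le> n"
    then obtain m where m: "n = Suc m" by (cases n) auto
    have "id \<in> N (Suc m)" using id_N .
    then have "basic_set R (restr m (ker f)) (ker f) \<noteq> {}" unfolding basic_set_ker[OF f] by blast
    moreover have "restr m (ker f) \<in> approximations R" using ker_in[OF f] by (auto simp: approximations_def)
    ultimately obtain A where A: "A \<in> basic_set R (restr m (ker f)) (ker f)"
      "basic_set R (restr m (ker f)) A \<in> \<Q>" using L ker_in[OF f] by blast
    then obtain g where g: "g \<in> N (Suc m)" "A = ker (g \<circ> f)" unfolding basic_set_ker[OF f] by blast
    have "basic_set R (restr m (ker f)) A = (\<lambda>h. ker (h \<circ> (g \<circ> f))) ` N n"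
      using basic_set_ker[OF comp_K[OF NM[OF g(1)] f], of m] g restr_ker_eq[OF f g(1)] m by simp
    then show "\<exists>g\<in>N n. (\<lambda>h. ker (h \<circ> (g \<circ> f))) ` N n \<in> \<Q>" using A g m by auto
  qed
next
  assume Rr: ?R
  show ?L
  proof (intro ballI impI)
    fix a B assume B: "B \<in> R" and ne: "basic_set R a B \<noteq> {}"
    then obtain A where "A \<in> basic_set R a B" by blast
    from basic_set_point[OF B this] obtain f n where f: "f \<in> K" "a = restr n (ker f)"
      "basic_set R a (ker f) \<subseteq> basic_set R a B" by metis
    obtain g where g: "g \<in> N (Suc n)" "(\<lambda>h. ker (h \<circ> (g \<circ> f))) ` N (Suc n) \<in> \<Q>"
      using Rr f(1) by (metis le_add1 plus_1_eq_Suc)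
    have "ker (g \<circ> f) \<in> basic_set R a (ker f)" using g(1) unfolding f(2) basic_set_ker[OF f(1)] by blast
    moreover have "basic_set R a (ker (g \<circ> f)) \<in> \<Q>"
      using basic_set_ker[OF comp_K[OF NM[OF g(1)] f(1)], of n] g restr_ker_eq[OF f(1) g(1)] f(2) by simp
    ultimately show "\<exists>A\<in>basic_set R a B. basic_set R a A \<in> \<Q>" using f(3) by blast
  qed
qed

lemma Ramsey_set_iff:
  "Ramsey_set R X \<longleftrightarrow> (\<forall>f\<in>K. \<forall>n\<ge>1. \<exists>g\<in>N n.
     (\<forall>h\<in>N n. ker (h \<circ> (g \<circ> f)) \<in> X) \<or> (\<forall>h\<in>N n. ker (h \<circ> (g \<circ> f)) \<notin> X))"
proof -
  let ?Q = "{Y. Y \<subseteq> X \<or> Y \<inter> X = {}}"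
  have Q: "F ` N n \<in> ?Q \<longleftrightarrow> (\<forall>h\<in>N n. F h \<in> X) \<or> (\<forall>h\<in>N n. F h \<notin> X)" for F n
    by blast
  have "Ramsey_set R X \<longleftrightarrow> (\<forall>a\<in>approximations R. \<forall>B\<in>R. basic_set R a B \<noteq> {} \<longrightarrow>
      (\<exists>A\<in>basic_set R a B. basic_set R a A \<in> ?Q))" unfolding Ramsey_set_def by simp
  also note basic_condition_iff
  finally show ?thesis unfolding Q .
qed

lemma Ramsey_null_set_iff: "Ramsey_null_set R X \<longleftrightarrow> null P {f. ker f \<in> X}"
proof -
  let ?Q = "{Y. Y \<inter> X = {}}"
  have Q: "(\<lambda>h. ker (h \<circ> f)) ` N n \<in> ?Q \<longleftrightarrow> (\<forall>h\<in>N n. h \<circ> f \<notin> {f. ker f \<in> X})" for f n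
    by blast
  have "Ramsey_null_set R X \<longleftrightarrow> (\<forall>a\<in>approximations R. \<forall>B\<in>R. basic_set R a B \<noteq> {} \<longrightarrow>
      (\<exists>A\<in>basic_set R a B. basic_set R a A \<in> ?Q))" unfolding Ramsey_null_set_def by simp
  also note basic_condition_iff
  finally show ?thesis unfolding Q null_def .
qed

section \<open>The Ellentuck topology in terms of orbits\<close>

lemma openin_ellentuck:
  "openin (ellentuck R) U \<longleftrightarrow>
     U \<subseteq> R \<and> (\<forall>f\<in>K. ker f \<in> U \<longrightarrow> (\<exists>n. \<forall>g\<in>N n. ker (g \<circ> f) \<in> U))" (is "_ \<longleftrightarrow> ?open U")
proof
  let ?B = "{basic_set R a B | a B. a \<in> approximations R \<and> B \<in> R}"
  assume "openin (ellentuck R) U"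
  then have "generate_topology_on ?B U" unfolding ellentuck_def openin_topology_generated_by_iff .
  then show "?open U"
  proof induction
    case (Int U V)
    show ?case
    proof (intro conjI ballI impI)
      fix f assume "f \<in> K" "ker f \<in> U \<inter> V"
      then obtain m n where "\<forall>g\<in>N m. ker (g \<circ> f) \<in> U" "\<forall>g\<in>N n. ker (g \<circ> f) \<in> V"
        using Int.IH by blast
      then show "\<exists>n. \<forall>g\<in>N n. ker (g \<circ> f) \<in> U \<inter> V"
        using N_mono[of m "max m n"] N_mono[of n "max m n"] by (intro exI[of _ "max m n"]) auto
    qed (use Int.IH in blast)
  next
    case (UN \<U>)
    show ?case
    proof (intro conjI ballI impI)
      fix f assume f: "f \<in> K" "ker f \<in> \<Union>\<U>"
      then obtain V where V: "V \<in> \<U>" "ker f \<in> V" by blast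
      then obtain n where "\<forall>g\<in>N n. ker (g \<circ> f) \<in> V" using UN.IH f by blast
      then show "\<exists>n. \<forall>g\<in>N n. ker (g \<circ> f) \<in> \<Union>\<U>" using V by blast
    qed (use UN.IH in blast)
  next
    case (Basis U)
    then obtain a B where U: "U = basic_set R a B" "B \<in> R" by blast
    show ?case
    proof (intro conjI ballI impI)
      fix f assume f: "f \<in> K" "ker f \<in> U"
      obtain h n where h: "ker f = ker h" "a = restr n (ker h)"
        "basic_set R a (ker h) \<subseteq> basic_set R a B"
        by (rule basic_set_point[OF U(2) f(2)[unfolded U(1)]]) (rule that)
      have "basic_set R a (ker f) = (\<lambda>g. ker (g \<circ> f)) ` N (Suc n)"
        unfolding h(2) h(1)[symmetric] by (rule basic_set_ker[OF f(1)])
      moreover have "basic_set R a (ker f) \<subseteq> U" using h(3) unfolding U(1) h(1) .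
      ultimately have "(\<lambda>g. ker (g \<circ> f)) ` N (Suc n) \<subseteq> U" by simp
      then show "\<exists>n. \<forall>g\<in>N n. ker (g \<circ> f) \<in> U" by blast
    qed (auto simp: U basic_set_def)
  qed simp
next
  assume U: "?open U"
  let ?B = "{basic_set R a B | a B. a \<in> approximations R \<and> B \<in> R}"
  have "\<exists>V. V \<in> ?B \<and> A \<in> V \<and> V \<subseteq> U" if A: "A \<in> U" for A
  proof -
    have "A \<in> R" using U A by blast
    then obtain f where f: "f \<in> K" "A = ker f" by (rule ker_surj)
    then obtain n where n: "\<forall>g\<in>N n. ker (g \<circ> f) \<in> U" using U A by blast
    define V where "V = basic_set R (restr n (ker f)) (ker f)"
    have V: "V = (\<lambda>g. ker (g \<circ> f)) ` N (Suc n)" unfolding V_def by (rule basic_set_ker[OF f(1)])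
    have "V \<in> ?B" using ker_in[OF f(1)] unfolding V_def approximations_def by blast
    moreover have "ker (id \<circ> f) \<in> V" using id_N unfolding V by blast
    moreover have "V \<subseteq> U" using n N_mono[of n "Suc n"] unfolding V by auto
    ultimately show ?thesis using f by auto
  qed
  then have "U = \<Union>{V \<in> ?B. V \<subseteq> U}" by blast
  moreover have "openin (ellentuck R) (\<Union>{V \<in> ?B. V \<subseteq> U})"
    unfolding ellentuck_def by (intro openin_Union) (auto intro: topology_generated_by_Basis)
  ultimately show "openin (ellentuck R) U" by simp
qed

lemma topspace_ellentuck: "topspace (ellentuck R) = R"
proof -
  have "openin (ellentuck R) R" unfolding openin_ellentuck using ker_in comp_K NM by blast
  then have "R \<subseteq> topspace (ellentuck R)" by (rule openin_subset)
  moreover have "topspace (ellentuck R) \<subseteq> R"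
    using openin_topspace[of "ellentuck R"] unfolding openin_ellentuck by blast
  ultimately show ?thesis by blast
qed

lemma open_neighbourhood: "f \<in> K \<Longrightarrow> openin (ellentuck R) ((\<lambda>h. ker (h \<circ> f)) ` N n)"
  unfolding openin_ellentuck
proof (intro conjI ballI impI subsetI)
  fix f' assume f: "f \<in> K" and f': "f' \<in> K" "ker f' \<in> (\<lambda>h. ker (h \<circ> f)) ` N n"
  then obtain h where h: "h \<in> N n" "ker f' = ker (h \<circ> f)" by blast
  have hf: "h \<circ> f \<in> K" using comp_K[OF NM[OF h(1)] f] .
  \<comment> \<open>A rigid surjection is determined by its kernel.\<close>
  have "f' x = (h \<circ> f) x" for x
    by (rule agree_below[OF f'(1) hf, of "Suc x"]) (use h(2) in \<open>auto simp: ker_def set_eq_iff\<close>)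
  then have "f' = h \<circ> f" by blast
  then show "\<exists>n'. \<forall>g\<in>N n'. ker (g \<circ> f') \<in> (\<lambda>h. ker (h \<circ> f)) ` N n"
    using comp_N[OF _ h(1)] by (intro exI[of _ n]) (auto simp: comp_assoc[symmetric] simp del: o_apply)
qed (use ker_in comp_K NM in blast)

section \<open>Meagre sets and the property of Baire\<close>

text \<open>The dichotomy is applied to the complement of the closure. The alternative of missing
  this complement would place an open orbit inside the closure, against its empty interior.\<close>

lemma null_if_nowhere_dense:
  assumes "nowhere_dense_in (ellentuck R) Y" shows "null P {f. ker f \<in> Y}"
  unfolding null_def
proof (intro ballI allI impI)
  fix f and n :: nat assume f: "f \<in> K" and n: "1 \<le> n"
  let ?T = "ellentuck R"
  define F where "F = ?T closure_of Y"
  have YF: "Y \<subseteq> F" and int: "?T interior_of F = {}"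
    using assms closure_of_subset unfolding nowhere_dense_in_def F_def by blast+
  have op: "openin ?T (topspace ?T - F)" 
    unfolding F_def by (intro openin_diff openin_topspace closedin_closure_of)
  have "\<exists>h\<in>N n. (\<forall>g\<in>N n. g \<circ> (h \<circ> f) \<in> {f \<in> K. ker f \<notin> F}) \<or> (\<forall>g\<in>N n. g \<circ> (h \<circ> f) \<notin> {f \<in> K. ker f \<notin> F})"
  proof (rule open_dichotomy[OF _ f n])
    fix f assume "f \<in> {f \<in> K. ker f \<notin> F}"
    then have "f \<in> K" "ker f \<in> topspace ?T - F" using ker_in topspace_ellentuck by auto
    then obtain m where "\<forall>g\<in>N m. ker (g \<circ> f) \<in> topspace ?T - F"
      using op unfolding openin_ellentuck by blast
    then show "\<exists>m. \<forall>g\<in>N m. g \<circ> f \<in> {f \<in> K. ker f \<notin> F}"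
      using comp_K[OF NM \<open>f \<in> K\<close>] by blast
  qed
  then obtain h where h: "h \<in> N n" and
    dich: "(\<forall>g\<in>N n. g \<circ> (h \<circ> f) \<in> {f \<in> K. ker f \<notin> F}) \<or> (\<forall>g\<in>N n. g \<circ> (h \<circ> f) \<notin> {f \<in> K. ker f \<notin> F})"
    by blast
  have hf: "h \<circ> f \<in> K" using comp_K[OF NM[OF h] f] .
  from dich have "\<forall>g\<in>N n. g \<circ> (h \<circ> f) \<notin> {f. ker f \<in> Y}"
  proof
    assume "\<forall>g\<in>N n. g \<circ> (h \<circ> f) \<notin> {f \<in> K. ker f \<notin> F}"
    then have "(\<lambda>g. ker (g \<circ> (h \<circ> f))) ` N n \<subseteq> F" using comp_K[OF NM hf] by blast
    then have "(\<lambda>g. ker (g \<circ> (h \<circ> f))) ` N n \<subseteq> ?T interior_of F"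
      using open_neighbourhood[OF hf] by (simp add: interior_of_maximal)
    then show ?thesis using int id_N by blast
  qed (use YF in blast)
  then show "\<exists>g\<in>N n. \<forall>h\<in>N n. h \<circ> (g \<circ> f) \<notin> {f. ker f \<in> Y}" using h by blast
qed

lemma nowhere_dense_if_null:
  assumes Y: "Y \<subseteq> R" and null: "null P {f. ker f \<in> Y}" shows "nowhere_dense_in (ellentuck R) Y"
  unfolding nowhere_dense_in_def
proof (intro conjI equals0I)
  let ?T = "ellentuck R"
  show "Y \<subseteq> topspace ?T" using Y topspace_ellentuck by simp
  fix A assume A: "A \<in> ?T interior_of (?T closure_of Y)"
  have "A \<in> R" using A interior_of_subset_topspace[of ?T] unfolding topspace_ellentuck by blast
  then obtain f where f: "f \<in> K" "A = ker f" by (rule ker_surj)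
  obtain n where n: "\<forall>g\<in>N n. ker (g \<circ> f) \<in> ?T interior_of (?T closure_of Y)"
    using A f openin_interior_of[of ?T] unfolding openin_ellentuck by blast
  obtain g where g: "g \<in> N (Suc n)" and miss: "\<forall>h\<in>N (Suc n). h \<circ> (g \<circ> f) \<notin> {f. ker f \<in> Y}"
    using null f(1) unfolding null_def by (metis le_add1 plus_1_eq_Suc)
  have gf: "g \<circ> f \<in> K" using comp_K[OF NM[OF g] f(1)] .
  define V where "V = (\<lambda>h. ker (h \<circ> (g \<circ> f))) ` N (Suc n)"
  have "openin ?T V" unfolding V_def by (rule open_neighbourhood[OF gf])
  moreover have "ker (id \<circ> (g \<circ> f)) \<in> V" unfolding V_def using id_N by blast
  then have "ker (g \<circ> f) \<in> V" by simp
  moreover have "ker (g \<circ> f) \<in> ?T closure_of Y"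
    using n g N_mono[of n "Suc n"] interior_of_subset[of ?T "?T closure_of Y"] by auto
  ultimately obtain B where "B \<in> V" "B \<in> Y" unfolding in_closure_of by blast
  then show False using miss unfolding V_def by blast
qed

text \<open>Countable unions are absorbed by \<open>null_UN\<close>; conversely a null set is
  already nowhere dense, so a constant sequence is enough.\<close>

lemma meagre_iff_null:
  assumes "X \<subseteq> R" shows "meagre_in (ellentuck R) X \<longleftrightarrow> null P {f. ker f \<in> X}"
proof
  assume "meagre_in (ellentuck R) X"
  then obtain Y :: "nat \<Rightarrow> nat rel set" where Y: "\<And>i. nowhere_dense_in (ellentuck R) (Y i)" "X = (\<Union>i. Y i)"
    unfolding meagre_in_def by blast
  have "null P (\<Union>i. {f. ker f \<in> Y i})" by (rule null_UN) (rule null_if_nowhere_dense[OF Y(1)])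
  moreover have "(\<Union>i. {f. ker f \<in> Y i}) = {f. ker f \<in> X}" unfolding Y(2) by blast
  ultimately show "null P {f. ker f \<in> X}" by simp
next
  assume "null P {f. ker f \<in> X}"
  then show "meagre_in (ellentuck R) X"
    unfolding meagre_in_def using nowhere_dense_if_null[OF assms] by (intro exI[of _ "\<lambda>_. X"]) auto
qed

text \<open>First \<open>U\<close> is decided, then a second shrinking avoids \<open>L\<close>;
  outside \<open>L\<close> the sets \<open>X\<close> and \<open>U\<close> coincide.\<close>

lemma Baire_imp_Ramsey:
  assumes "Baire_property_in (ellentuck R) X" shows "Ramsey_set R X"
  unfolding Ramsey_set_iff
proof (intro ballI allI impI)
  fix f and n :: nat assume f: "f \<in> K" and n: "1 \<le> n"
  obtain U L where U: "openin (ellentuck R) U" and L: "meagre_in (ellentuck R) L"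
    and X: "X = (U - L) \<union> (L - U)" using assms unfolding Baire_property_in_def by blast
  have "L \<subseteq> R" using L topspace_ellentuck unfolding meagre_in_def nowhere_dense_in_def by blast
  with L have nl: "null P {f. ker f \<in> L}" using meagre_iff_null by blast
  have "\<exists>h\<in>N n. (\<forall>g\<in>N n. g \<circ> (h \<circ> f) \<in> {f \<in> K. ker f \<in> U}) \<or> (\<forall>g\<in>N n. g \<circ> (h \<circ> f) \<notin> {f \<in> K. ker f \<in> U})"
  proof (rule open_dichotomy[OF _ f n])
    fix f assume "f \<in> {f \<in> K. ker f \<in> U}"
    then show "\<exists>m. \<forall>g\<in>N m. g \<circ> f \<in> {f \<in> K. ker f \<in> U}"
      using U comp_K[OF NM] unfolding openin_ellentuck by blast
  qed
  then obtain h where h: "h \<in> N n" and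
    dich: "(\<forall>g\<in>N n. g \<circ> (h \<circ> f) \<in> {f \<in> K. ker f \<in> U}) \<or> (\<forall>g\<in>N n. g \<circ> (h \<circ> f) \<notin> {f \<in> K. ker f \<in> U})"
    by blast
  have hf: "h \<circ> f \<in> K" using comp_K[OF NM[OF h] f] .
  obtain k where k: "k \<in> N n" "\<forall>g\<in>N n. g \<circ> (k \<circ> (h \<circ> f)) \<notin> {f. ker f \<in> L}"
    using nl hf n unfolding null_def by blast
  define g where "g = k \<circ> h"
  have g: "g \<in> N n" unfolding g_def using comp_N[OF k(1) h] .
  have eq: "q \<circ> (g \<circ> f) = q \<circ> (k \<circ> (h \<circ> f))" "q \<circ> (g \<circ> f) = (q \<circ> k) \<circ> (h \<circ> f)" for q
    by (simp_all add: g_def comp_assoc)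
  have notL: "ker (q \<circ> (g \<circ> f)) \<notin> L" if "q \<in> N n" for q using k(2) that unfolding eq(1) by blast
  from dich have "(\<forall>q\<in>N n. ker (q \<circ> (g \<circ> f)) \<in> U) \<or> (\<forall>q\<in>N n. ker (q \<circ> (g \<circ> f)) \<notin> U)"
    unfolding eq(2) using comp_N[OF _ k(1)] comp_K[OF NM hf] by blast
  then show "\<exists>g\<in>N n. (\<forall>q\<in>N n. ker (q \<circ> (g \<circ> f)) \<in> X) \<or> (\<forall>q\<in>N n. ker (q \<circ> (g \<circ> f)) \<notin> X)"
    using g notL unfolding X by blast
qed

text \<open>The open part is the interior \<open>U\<close> of \<open>X\<close>. An orbit contained
  in \<open>X\<close> is open and so lies in \<open>U\<close>; hence in either Ramsey alternative
  the orbit misses \<open>X - U\<close>.\<close>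

lemma Ramsey_imp_Baire:
  assumes X: "X \<subseteq> R" and Ram: "Ramsey_set R X" shows "Baire_property_in (ellentuck R) X"
proof -
  let ?T = "ellentuck R"
  define U where "U = ?T interior_of X"
  have UX: "U \<subseteq> X" and U: "openin ?T U" unfolding U_def by (auto simp: interior_of_subset)
  have "null P {f. ker f \<in> X - U}" unfolding null_def
  proof (intro ballI allI impI)
    fix f and n :: nat assume f: "f \<in> K" and n: "1 \<le> n"
    then obtain g where g: "g \<in> N n"
      and dich: "(\<forall>h\<in>N n. ker (h \<circ> (g \<circ> f)) \<in> X) \<or> (\<forall>h\<in>N n. ker (h \<circ> (g \<circ> f)) \<notin> X)"
      using Ram unfolding Ramsey_set_iff by blast
    have gf: "g \<circ> f \<in> K" using comp_K[OF NM[OF g] f] .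
    from dich have "\<forall>h\<in>N n. h \<circ> (g \<circ> f) \<notin> {f. ker f \<in> X - U}"
    proof
      assume "\<forall>h\<in>N n. ker (h \<circ> (g \<circ> f)) \<in> X"
      then have "(\<lambda>h. ker (h \<circ> (g \<circ> f))) ` N n \<subseteq> U"
        unfolding U_def by (intro interior_of_maximal open_neighbourhood[OF gf]) blast
      then show ?thesis by blast
    qed blast
    then show "\<exists>g\<in>N n. \<forall>h\<in>N n. h \<circ> (g \<circ> f) \<notin> {f. ker f \<in> X - U}" using g by blast
  qed
  then have "meagre_in ?T (X - U)" using meagre_iff_null[of "X - U"] X by blast
  moreover have "X = (U - (X - U)) \<union> ((X - U) - U)" using UX by blast
  ultimately show ?thesis using U unfolding Baire_property_in_def by blast
qed

theorem topological_Ramsey: "topological_Ramsey_space R"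
  unfolding topological_Ramsey_space_def
  using Baire_imp_Ramsey Ramsey_imp_Baire meagre_iff_null Ramsey_null_set_iff
  by (auto simp: coloured_equivs_def)

end

theorem theorem3p1:
  fixes l :: nat and P :: "nat \<Rightarrow> nat set"
  assumes "l \<ge> 1"
    and "(\<Union>i<l. P i) = UNIV"
    and "disjoint_family_on P {..<l}"
    and "\<And>i. i < l \<Longrightarrow> infinite (P i)"
    and "\<And>i j. i < j \<Longrightarrow> j < l \<Longrightarrow> (LEAST x. x \<in> P i) < (LEAST x. x \<in> P j)"
  shows "topological_Ramsey_space (coloured_equivs l P)"
proof -
  interpret coloured_space l P by unfold_locales (use assms in auto)
  show ?thesis by (rule topological_Ramsey)
qed

end
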